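(* For the Budgeted-UCB algorithm $A$ run with budget $B$ (described in the context), the expected regret satisfies $$\mathbb{E}[Reg_B(A)]\le \log(MU_{I^*})\left(1+\frac{c_{\min}}{c_{I^*}}+\sum_{i:\,\delta_i>0}\frac{\delta_i}{c_{I^*}}\left(\frac{8\log\!\big(\frac{B}{Mc_{\min}}\big)}{Mc_i^2\Delta_i^2}+1+\frac{\pi^2}{3}\right)\right)+\log\!\Big(\frac{U_{I^*}}{u_{\min}}\Big)\,N\max_{i\neq I^*}\left(\frac{8\log\!\big(\frac{B}{Mc_{\min}}\big)}{Mc_i^2\Delta_i^2}+1+\frac{\pi^2}{3}\right).$$ In particular the expected regret is $\mathcal{O}(\log B)$.
   Context: Setting: $N$ arms (meta computers) $\mathcal{N}=\{1,\dots,N\}$, $M$ users, total budget $B>0$. Arm $i$ has known unit cost $c_i>0$; $c_{\min}=\min_i c_i$. Selecting arm $i$ in round $t$ costs $Mc_i$ and reveals $M$ QoE values $u_{i1}(t),\dots,u_{iM}(t)$; all QoE values are mutually independent, those of arm $i$ have mean $U_i$, and all lie in $[u_{\min},u_{\max}]$ with $1\le u_{\min}\le u_{\max}\le2$. $\log$ is the natural logarithm. Budgeted-UCB: let $A(t)$ be the arm chosen in round $t$, $T_i(t)=\sum_{k\le t}\mathbb{I}\{A(k)=i\}$, $B_0=B$, $B_t=B_{t-1}-Mc_{A(t)}$. The empirical mean $\hat u_i(t)$ is the average of all $T_i(t)M$ QoE values observed for arm $i$ up to round $t$; the UCB index is $\bar u_i(t)=\hat u_i(t)+\sqrt{2\log(t)/(T_i(t)M)}$.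 In rounds $t=1,\dots,N$ the algorithm selects arm $t$ (assume $B$ is large enough that $\tau(B)\ge N$). Afterwards, while $B_{t}\ge Mc_{\min}$, in round $t+1$ it selects $A(t+1)\in\arg\max_{\{i:\,Mc_i\le B_{t}\}}\log(\bar u_i(t))/c_i$, observes its $M$ QoE values and updates. $\tau(B)$ denotes the last round executed. The optimal arm is $I^*=\arg\max_i\log(U_i)/c_i$ (assumed unique); for $i\neq I^*$, $\Delta_i=\frac{\log(U_{I^*})}{c_{I^*}}-\frac{\log(U_i)}{c_i}$, and $\delta_i=c_i-c_{I^*}$. Reward and regret: the reward of the algorithm is $R_B(A)=\sum_{t=1}^{\tau(B)}\log\big(\sum_{j=1}^M u_{A(t)j}(t)\big)$. The benchmark (oracle knowing all $U_i$) always selects $I^*$, and its reward is bounded by $R_B(A^* )\le\sum_{t=1}^{\lfloor B/(Mc_{I^*})\rfloor+1}\log\big(\sum_{j=1}^M u_{I^*j}(t)\big)$. The expected regret is $\mathbb{E}[Reg_B(A)]=\mathbb{E}[R_B(A^* )]-\mathbb{E}[R_B(A)]$, the expectation taken over the QoE observations (hence over $\tau(B)$ and the choices $A(t)$). *)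

theory Defs
  imports "HOL-Probability.Probability"
begin

text \<open>Arms are 1..N, users are 1..M, rounds are 1,2,...
  A history hs is the list [A(1),...,A(t)] of arms chosen so far.
  QoE values: u i j t w = QoE of user j at arm i in round t (sample point w).\<close>

definition pulls :: "nat list \<Rightarrow> nat \<Rightarrow> nat" where
  "pulls hs i = length (filter (\<lambda>a. a = i) hs)"

definition budget_left :: "nat \<Rightarrow> (nat \<Rightarrow> real) \<Rightarrow> real \<Rightarrow> nat list \<Rightarrow> real" where
  "budget_left M c B hs = B - (\<Sum>k<length hs. real M * c (hs ! k))"

definition emp_mean ::
  "nat \<Rightarrow> (nat \<Rightarrow> nat \<Rightarrow> nat \<Rightarrow> 'a \<Rightarrow> real) \<Rightarrow> nat list \<Rightarrow> nat \<Rightarrow> 'a \<Rightarrow> real" where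
  "emp_mean M u hs i w =
     (\<Sum>k\<in>{k. k < length hs \<and> hs ! k = i}. \<Sum>j=1..M. u i j (Suc k) w)
       / (real (pulls hs i) * real M)"

definition ucb_index ::
  "nat \<Rightarrow> (nat \<Rightarrow> nat \<Rightarrow> nat \<Rightarrow> 'a \<Rightarrow> real) \<Rightarrow> nat list \<Rightarrow> nat \<Rightarrow> 'a \<Rightarrow> real" where
  "ucb_index M u hs i w =
     emp_mean M u hs i w + sqrt (2 * ln (real (length hs)) / (real (pulls hs i) * real M))"

definition cmin :: "nat \<Rightarrow> (nat \<Rightarrow> real) \<Rightarrow> real" where
  "cmin N c = Min (c ` {1..N})"

text \<open>Arm selected in the next round given history hs (None = the algorithm stops).
  Ties in the argmax are broken by an arbitrary rule pick (returning a member of the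
  nonempty finite set of maximisers).\<close>
definition next_arm ::
  "nat \<Rightarrow> nat \<Rightarrow> (nat \<Rightarrow> real) \<Rightarrow> real \<Rightarrow> (nat set \<Rightarrow> nat)
    \<Rightarrow> (nat \<Rightarrow> nat \<Rightarrow> nat \<Rightarrow> 'a \<Rightarrow> real) \<Rightarrow> nat list \<Rightarrow> 'a \<Rightarrow> nat option" where
  "next_arm N M c B pick u hs w =
     (if length hs < N then Some (Suc (length hs))
      else if real M * cmin N c \<le> budget_left M c B hs then
        (let F = {i \<in> {1..N}. real M * c i \<le> budget_left M c B hs};
             g = (\<lambda>i. ln (ucb_index M u hs i w) / c i)
         in Some (pick {i \<in> F. \<forall>i'\<in>F. g i' \<le> g i}))
      else None)"

primrec hist ::
  "nat \<Rightarrow> nat \<Rightarrow> (nat \<Rightarrow> real) \<Rightarrow> real \<Rightarrow> (nat set \<Rightarrow> nat)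
    \<Rightarrow> (nat \<Rightarrow> nat \<Rightarrow> nat \<Rightarrow> 'a \<Rightarrow> real) \<Rightarrow> nat \<Rightarrow> 'a \<Rightarrow> nat list" where
  "hist N M c B pick u 0 w = []"
| "hist N M c B pick u (Suc t) w =
     (case next_arm N M c B pick u (hist N M c B pick u t w) w of
        None \<Rightarrow> hist N M c B pick u t w
      | Some a \<Rightarrow> hist N M c B pick u t w @ [a])"

definition tau ::
  "nat \<Rightarrow> nat \<Rightarrow> (nat \<Rightarrow> real) \<Rightarrow> real \<Rightarrow> (nat set \<Rightarrow> nat)
    \<Rightarrow> (nat \<Rightarrow> nat \<Rightarrow> nat \<Rightarrow> 'a \<Rightarrow> real) \<Rightarrow> 'a \<Rightarrow> nat" where
  "tau N M c B pick u w =
     (LEAST t. next_arm N M c B pick u (hist N M c B pick u t w) w = None)"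

text \<open>A(t) for 1 <= t <= tau(B).\<close>
definition arm_at ::
  "nat \<Rightarrow> nat \<Rightarrow> (nat \<Rightarrow> real) \<Rightarrow> real \<Rightarrow> (nat set \<Rightarrow> nat)
    \<Rightarrow> (nat \<Rightarrow> nat \<Rightarrow> nat \<Rightarrow> 'a \<Rightarrow> real) \<Rightarrow> nat \<Rightarrow> 'a \<Rightarrow> nat" where
  "arm_at N M c B pick u t w =
     hist N M c B pick u (tau N M c B pick u w) w ! (t - 1)"

definition alg_reward ::
  "nat \<Rightarrow> nat \<Rightarrow> (nat \<Rightarrow> real) \<Rightarrow> real \<Rightarrow> (nat set \<Rightarrow> nat)
    \<Rightarrow> (nat \<Rightarrow> nat \<Rightarrow> nat \<Rightarrow> 'a \<Rightarrow> real) \<Rightarrow> 'a \<Rightarrow> real" where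
  "alg_reward N M c B pick u w =
     (\<Sum>t=1..tau N M c B pick u w.
        ln (\<Sum>j=1..M. u (arm_at N M c B pick u t w) j t w))"

definition bench_reward ::
  "nat \<Rightarrow> (nat \<Rightarrow> real) \<Rightarrow> real \<Rightarrow> nat
    \<Rightarrow> (nat \<Rightarrow> nat \<Rightarrow> nat \<Rightarrow> 'a \<Rightarrow> real) \<Rightarrow> 'a \<Rightarrow> real" where
  "bench_reward M c B istar u w =
     (\<Sum>t=1..nat \<lfloor>B / (real M * c istar)\<rfloor> + 1. ln (\<Sum>j=1..M. u istar j t w))"

definition exp_regret ::
  "'a measure \<Rightarrow> nat \<Rightarrow> nat \<Rightarrow> (nat \<Rightarrow> real) \<Rightarrow> real \<Rightarrow> (nat set \<Rightarrow> nat) \<Rightarrow> nat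
    \<Rightarrow> (nat \<Rightarrow> nat \<Rightarrow> nat \<Rightarrow> 'a \<Rightarrow> real) \<Rightarrow> real" where
  "exp_regret P N M c B pick istar u =
     (\<integral>w. bench_reward M c B istar u w \<partial>P) - (\<integral>w. alg_reward N M c B pick u w \<partial>P)"

end

theory Submission
  imports Defs
begin

text \<open>By independence of round \<open>t\<close> from the past, the regret is at most the expectation of
  \<open>ln (M U\<^sub>*)\<close> per benchmark round after the algorithm has stopped plus \<open>ln (U\<^sub>* / umin)\<close> per
  suboptimal selection. The budget equation turns the number of missing rounds into a weighted count of
  selections of arms dearer than the optimal one. The selections of a suboptimal arm are counted as for UCB1:
  once the arm has more than the logarithmic number of pulls, choosing it requires a deviation of
  its own or of the optimal arm's empirical mean, and since pulls are adaptive, such deviations are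
  controlled by an exponential supermartingale instead of the fixed-sample Hoeffding inequality.

  The UCB comparison fails in the final phase, when the optimal arm is no longer affordable. The
  total amount spent in that phase is less than the price of one optimal pull, so it costs at most
  one extra \<open>ln (U\<^sub>* / umin)\<close>; this is covered by the factor \<open>N\<close> in the bound, where only
  \<open>N - 1\<close> suboptimal arms occur.\<close>

section \<open>Pull counts and remaining budget of a history\<close>

lemma pulls_snoc: "pulls (hs @ [a]) i = (if a = i then Suc (pulls hs i) else pulls hs i)"
  by (simp add: pulls_def)

lemma pulls_le_length: "pulls hs i \<le> length hs"
  by (simp add: pulls_def)

lemma pulls_pos_iff: "0 < pulls hs i \<longleftrightarrow> i \<in> set hs"
  by (auto simp: pulls_def filter_empty_conv)

lemma budget_left_Nil [simp]: "budget_left M c B [] = B"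
  by (simp add: budget_left_def)

lemma budget_left_snoc: "budget_left M c B (hs @ [a]) = budget_left M c B hs - real M * c a"
  by (simp add: budget_left_def nth_append)

section \<open>Runs of the algorithm at a fixed sample point\<close>

locale budgeted_arms =
  fixes N M :: nat and c :: "nat \<Rightarrow> real" and B :: real and pick :: "nat set \<Rightarrow> nat"
  assumes N2: "N \<ge> 2" and M1: "M \<ge> 1"
    and cpos: "\<forall>i\<in>{1..N}. c i > 0"
    and Blarge: "B \<ge> real M * (\<Sum>i=1..N. c i)"
    and pick: "\<forall>S. finite S \<and> S \<noteq> {} \<longrightarrow> pick S \<in> S"
begin

abbreviation "H \<equiv> hist N M c B pick"
abbreviation "next_of \<equiv> next_arm N M c B pick"
text \<open>\<open>k\<close> counts completed rounds, so \<open>next_at u k w\<close> is the arm of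
  round \<open>k + 1\<close>. The value \<open>None\<close> means that the run is over;
  \<open>H\<close> is then constant from \<open>k\<close> on.\<close>

abbreviation "next_at u k w \<equiv> next_of u (H u k w) w"
abbreviation "left \<equiv> budget_left M c B"

lemma Mpos: "real M > 0" using M1 by simp

lemma cmin_pos: "cmin N c > 0"
  unfolding cmin_def using N2 cpos by (subst Min_gr_iff) auto

lemma cmin_le: "i \<in> {1..N} \<Longrightarrow> cmin N c \<le> c i"
  unfolding cmin_def by (intro Min_le) auto

lemma cmin_attained: "\<exists>i\<in>{1..N}. c i = cmin N c"
proof -
  have "Min (c ` {1..N}) \<in> c ` {1..N}" using N2 by (intro Min_in) auto
  thus ?thesis by (auto simp: cmin_def)
qed

text \<open>\<open>pick\<close> is constrained only on finite nonempty sets. The stopping test makes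
  a cheapest arm affordable, so \<open>F\<close> is nonempty and has a maximiser.\<close>

lemma next_of_greedy:
  assumes "N \<le> length hs" "next_of u hs w = Some a"
  defines "g \<equiv> \<lambda>i. ln (ucb_index M u hs i w) / c i"
  shows "a \<in> {1..N}" "real M * c a \<le> left hs"
    "\<And>i. i \<in> {1..N} \<Longrightarrow> real M * c i \<le> left hs \<Longrightarrow> g i \<le> g a"
proof -
  define F where "F = {i \<in> {1..N}. real M * c i \<le> left hs}"
  define S where "S = {i \<in> F. \<forall>i'\<in>F. g i' \<le> g i}"
  have aff: "real M * cmin N c \<le> left hs" and a: "a = pick S"
    using assms(1,2) by (auto simp: next_arm_def Let_def F_def S_def g_def split: if_splits)
  have fin: "finite F" by (simp add: F_def)
  have "F \<noteq> {}" using cmin_attained aff by (force simp: F_def)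
  then have "Max (g ` F) \<in> g ` F" using fin by (intro Max_in) auto
  then obtain m where "m \<in> F" "g m = Max (g ` F)" by auto
  then have "m \<in> S" using fin by (auto simp: S_def)
  moreover have "finite S" using fin by (simp add: S_def)
  ultimately have "a \<in> S" using pick a by blast
  then show "a \<in> {1..N}" "real M * c a \<le> left hs"
    "\<And>i. i \<in> {1..N} \<Longrightarrow> real M * c i \<le> left hs \<Longrightarrow> g i \<le> g a"
    by (auto simp: S_def F_def)
qed

lemma next_of_initial: "length hs < N \<Longrightarrow> next_of u hs w = Some (Suc (length hs))"
  by (simp add: next_arm_def)

lemma hist_initial: "t \<le> N \<Longrightarrow> H u t w = [1..<Suc t]"
  by (induction t) (auto simp: next_of_initial)

lemma left_initial: "t \<le> N \<Longrightarrow> left [1..<Suc t] = B - real M * (\<Sum>i=1..t. c i)"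
proof (induction t)
  case (Suc t)
  then show ?case by (simp add: budget_left_snoc algebra_simps)
qed simp

text \<open>A stopped run never resumes, because the unchanged history yields \<open>None\<close>
  again. Activity at \<open>t\<close> therefore means that each of the first \<open>t\<close> steps
  appended an arm.\<close>

lemma length_hist: "next_at u t w \<noteq> None \<Longrightarrow> length (H u t w) = t"
proof (induction t)
  case (Suc t)
  then show ?case by (cases "next_at u t w") auto
qed simp

lemma length_hist_le: "length (H u t w) \<le> t"
  by (induction t) (auto split: option.splits)

lemma next_at_Suc: "next_at u (Suc t) w \<noteq> None \<Longrightarrow> next_at u t w \<noteq> None"
  by (cases "next_at u t w") auto

lemma next_at_antimono: "s \<le> t \<Longrightarrow> next_at u t w \<noteq> None \<Longrightarrow> next_at u s w \<noteq> None"
proof (induction t rule: dec_induct)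
  case (step n)
  then show ?case using next_at_Suc[of u n w] by blast
qed simp

text \<open>The initial rounds are played without a budget test; there \<open>Blarge\<close> pays
  for every prefix of arms \<open>1..N\<close>.\<close>

lemma next_at_affordable:
  assumes "next_at u t w = Some a"
  shows "a \<in> {1..N} \<and> real M * c a \<le> left (H u t w)"
proof (cases "t < N")
  case True
  then have h: "H u t w = [1..<Suc t]" by (intro hist_initial) auto
  then have len: "length (H u t w) = t" by (simp del: upt_Suc)
  have a: "a = Suc t" using assms True next_of_initial[of "H u t w" u w] len by simp
  have "(\<Sum>i=1..Suc t. c i) \<le> (\<Sum>i=1..N. c i)"
    using True cpos by (intro sum_mono2) (auto intro: less_imp_le)
  then have "real M * (\<Sum>i=1..Suc t. c i) \<le> B"
    using Blarge Mpos by (meson mult_left_mono less_imp_le order_trans)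
  then show ?thesis using True a left_initial[of t] h by (simp add: algebra_simps del: upt_Suc)
next
  case False
  then have "N \<le> length (H u t w)" using length_hist[of u t w] assms by simp
  from next_of_greedy(1,2)[OF this assms] show ?thesis by simp
qed

lemma next_at_range: "next_at u t w = Some a \<Longrightarrow> a \<in> {1..N}"
  using next_at_affordable[of u t w a] by simp

lemma B_nonneg: "B \<ge> 0"
proof -
  have "(\<Sum>i=1..N. c i) \<ge> 0" using cpos by (intro sum_nonneg) (auto intro: less_imp_le)
  then have "real M * (\<Sum>i=1..N. c i) \<ge> 0" by simp
  then show ?thesis using Blarge by linarith
qed

lemma left_nonneg: "left (H u t w) \<ge> 0"
proof (induction t)
  case (Suc t)
  then show ?case using next_at_affordable[of u t w]
    by (auto simp: budget_left_snoc split: option.splits)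
qed (use B_nonneg in auto)

lemma left_hist_le: "left (H u t w) \<le> B - real M * cmin N c * length (H u t w)"
proof (induction t)
  case (Suc t)
  show ?case
  proof (cases "next_at u t w")
    case (Some a)
    have "real M * cmin N c \<le> real M * c a"
      using next_at_range[OF Some] cmin_le Mpos by simp
    then show ?thesis using Suc Some by (simp add: budget_left_snoc algebra_simps)
  qed (use Suc in auto)
qed simp

text \<open>After round \<open>t + 1\<close> the budget is still nonnegative, although every round
  has cost at least \<open>real M * cmin N c\<close>.\<close>

lemma Suc_le_of_active:
  assumes "next_at u t w = Some a"
  shows "real (Suc t) \<le> B / (real M * cmin N c)"
proof -
  have "left (H u (Suc t) w) \<le> B - real M * cmin N c * length (H u (Suc t) w)"
    by (rule left_hist_le)
  moreover have "length (H u (Suc t) w) = Suc t"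
    using assms length_hist[of u t w] by simp
  ultimately have "real M * cmin N c * real (Suc t) \<le> B"
    using left_nonneg[of u "Suc t" w] by simp
  then show ?thesis using Mpos cmin_pos by (simp add: field_simps)
qed

text \<open>A deterministic bound on the stopping time: it makes the \<open>LEAST\<close> in
  \<open>tau\<close> meaningful and turns sums of random length into sums over a fixed
  range.\<close>

definition horizon :: nat where "horizon = nat \<lfloor>B / (real M * cmin N c)\<rfloor>"

lemma inactive_horizon: "next_at u horizon w = None"
proof (rule ccontr)
  assume "next_at u horizon w \<noteq> None"
  then obtain a where "next_at u horizon w = Some a" by blast
  from Suc_le_of_active[OF this] show False unfolding horizon_def by linarith
qed

abbreviation "stop \<equiv> tau N M c B pick"

lemma inactive_stop: "next_at u (stop u w) w = None"
  unfolding tau_def by (rule LeastI[where P = "\<lambda>t. next_at u t w = None", OF inactive_horizon])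

lemma stop_le_horizon: "stop u w \<le> horizon"
  unfolding tau_def by (rule Least_le[where P = "\<lambda>t. next_at u t w = None", OF inactive_horizon])

lemma active_iff: "next_at u k w \<noteq> None \<longleftrightarrow> k < stop u w"
proof
  show "k < stop u w" if "next_at u k w \<noteq> None"
    using next_at_antimono[of "stop u w" k u w] inactive_stop[of u w] that by (metis not_le)
  show "next_at u k w \<noteq> None" if "k < stop u w"
    using not_less_Least that unfolding tau_def by blast
qed

abbreviation "choice u k w \<equiv> the (next_at u k w)"

lemma next_at_eq_choice: "k < stop u w \<Longrightarrow> next_at u k w = Some (choice u k w)"
  using active_iff[of u k w] by auto

lemma hist_eq_choices: "t \<le> stop u w \<Longrightarrow> H u t w = map (\<lambda>k. choice u k w) [0..<t]"
proof (induction t)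
  case (Suc t)
  then have n: "next_at u t w = Some (choice u t w)" by (intro next_at_eq_choice) auto
  have "H u (Suc t) w = H u t w @ [choice u t w]"
    unfolding hist.simps(2) by (subst n) simp
  also have "\<dots> = map (\<lambda>k. choice u k w) [0..<Suc t]" using Suc by simp
  finally show ?case .
qed simp

lemma left_hist: "t \<le> stop u w \<Longrightarrow> left (H u t w) = B - real M * (\<Sum>k<t. c (choice u k w))"
  by (simp add: hist_eq_choices budget_left_def sum_distrib_left)

lemma arm_at_eq: "k < stop u w \<Longrightarrow> arm_at N M c B pick u (Suc k) w = choice u k w"
  unfolding arm_at_def by (subst hist_eq_choices) auto

text \<open>Padding with zeros after the stopping time makes the range deterministic, so that
  expectations can be taken term by term. The index is shifted from round \<open>t\<close> to
  \<open>k = t - 1\<close>.\<close>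

lemma alg_reward_eq:
  assumes "stop u w \<le> T"
  shows "alg_reward N M c B pick u w =
    (\<Sum>k<T. if next_at u k w = None then 0 else ln (\<Sum>j=1..M. u (choice u k w) j (Suc k) w))"
proof -
  have "alg_reward N M c B pick u w =
    (\<Sum>k<stop u w. ln (\<Sum>j=1..M. u (arm_at N M c B pick u (Suc k) w) j (Suc k) w))"
    unfolding alg_reward_def by (simp add: sum.atLeast1_atMost_eq)
  also have "\<dots> = (\<Sum>k<stop u w. if next_at u k w = None then 0
      else ln (\<Sum>j=1..M. u (choice u k w) j (Suc k) w))"
    by (intro sum.cong refl) (use active_iff[of u _ w] in \<open>auto simp: arm_at_eq simp flip: active_iff\<close>)
  also have "\<dots> = (\<Sum>k<T. if next_at u k w = None then 0
      else ln (\<Sum>j=1..M. u (choice u k w) j (Suc k) w))"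
    using assms active_iff[of u _ w] by (intro sum.mono_neutral_left) auto
  finally show ?thesis .
qed

lemma left_after_stop: "left (H u (stop u w) w) < real M * cmin N c"
proof (rule ccontr)
  assume "\<not> ?thesis"
  then have "next_at u (stop u w) w \<noteq> None"
    unfolding next_arm_def by (auto simp: Let_def)
  with inactive_stop[of u w] show False by simp
qed

section \<open>Non-anticipation and measurability of the run\<close>

text \<open>\<open>u\<close> at \<open>w\<close> and \<open>v\<close> at \<open>x\<close> may live
  on different sample spaces; later \<open>v\<close> consists of coordinate functions of a product
  space.\<close>

lemma ucb_index_cong:
  assumes "\<And>i j k. i \<in> {1..N} \<Longrightarrow> j \<in> {1..M} \<Longrightarrow> k \<in> {1..length hs} \<Longrightarrow> u i j k w = v i j k x"
    and "i \<in> {1..N}"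
  shows "ucb_index M u hs i w = ucb_index M v hs i x"
proof -
  have "(\<Sum>k\<in>{k. k < length hs \<and> hs ! k = i}. \<Sum>j=1..M. u i j (Suc k) w) =
    (\<Sum>k\<in>{k. k < length hs \<and> hs ! k = i}. \<Sum>j=1..M. v i j (Suc k) x)"
    using assms by (intro sum.cong) auto
  then show ?thesis by (simp add: ucb_index_def emp_mean_def)
qed

lemma next_of_cong:
  assumes "\<And>i j k. i \<in> {1..N} \<Longrightarrow> j \<in> {1..M} \<Longrightarrow> k \<in> {1..length hs} \<Longrightarrow> u i j k w = v i j k x"
  shows "next_of u hs w = next_of v hs x"
proof -
  have *: "ucb_index M u hs i w = ucb_index M v hs i x" if "i \<in> {1..N}" for i
    using assms that by (rule ucb_index_cong)
  define F where "F = {i \<in> {1..N}. real M * c i \<le> left hs}"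
  have "{i \<in> F. \<forall>i'\<in>F. ln (ucb_index M u hs i' w) / c i' \<le> ln (ucb_index M u hs i w) / c i} =
    {i \<in> F. \<forall>i'\<in>F. ln (ucb_index M v hs i' x) / c i' \<le> ln (ucb_index M v hs i x) / c i}"
    using * by (auto simp: F_def)
  then show ?thesis by (simp add: next_arm_def Let_def F_def)
qed

lemma hist_cong:
  assumes "\<And>i j k. i \<in> {1..N} \<Longrightarrow> j \<in> {1..M} \<Longrightarrow> k \<in> {1..t} \<Longrightarrow> u i j k w = v i j k x"
  shows "H u t w = H v t x"
  using assms
proof (induction t)
  case (Suc t)
  have eq: "H u t w = H v t x" using Suc by (intro Suc.IH) auto
  have "next_at u t w = next_of v (H u t w) x"
    using Suc.prems length_hist_le[of u t w] by (intro next_of_cong) auto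
  then have nx: "next_at u t w = next_at v t x" using eq by simp
  show ?case by (simp only: hist.simps nx) (simp only: eq)
qed simp

lemma next_at_cong:
  assumes "\<And>i j k. i \<in> {1..N} \<Longrightarrow> j \<in> {1..M} \<Longrightarrow> k \<in> {1..t} \<Longrightarrow> u i j k w = v i j k x"
  shows "next_at u t w = next_at v t x"
proof -
  have "H u t w = H v t x" using assms by (rule hist_cong)
  moreover have "next_at u t w = next_of v (H u t w) x"
    using assms length_hist_le[of u t w] by (intro next_of_cong) auto
  ultimately show ?thesis by simp
qed

text \<open>Nothing regular is known about the tie-breaking rule \<open>pick\<close>. The set of
  maximisers is therefore treated as a random variable in the finite discrete space
  \<open>Pow F\<close>, from which every function is measurable.\<close>

lemma measurable_next_of:
  assumes [measurable]: "\<And>i j k. u i j k \<in> borel_measurable Q"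
  shows "next_of u hs \<in> measurable Q (count_space UNIV)"
proof -
  define F where "F = {i \<in> {1..N}. real M * c i \<le> left hs}"
  define g where "g = (\<lambda>i w. ln (ucb_index M u hs i w) / c i)"
  define S where "S = (\<lambda>w. {i \<in> F. \<forall>i'\<in>F. g i' w \<le> g i w})"
  have [measurable]: "g i \<in> borel_measurable Q" for i
    unfolding g_def ucb_index_def emp_mean_def by measurable
  have fin: "finite F" by (simp add: F_def)
  have "S \<in> measurable Q (count_space (Pow F))"
  proof (subst measurable_count_space_eq2)
    show "S \<in> space Q \<rightarrow> Pow F \<and> (\<forall>X\<in>Pow F. S -` {X} \<inter> space Q \<in> sets Q)"
    proof (intro conjI ballI)
      fix X assume "X \<in> Pow F"
      then have "S -` {X} \<inter> space Q = {w \<in> space Q. \<forall>i\<in>F. i \<in> X \<longleftrightarrow> (\<forall>i'\<in>F. g i' w \<le> g i w)}"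
        by (auto simp: S_def)
      also have "\<dots> \<in> sets Q" using fin by measurable
      finally show "S -` {X} \<inter> space Q \<in> sets Q" .
    qed (auto simp: S_def)
  qed (use fin in simp)
  then have "(\<lambda>w. Some (pick (S w))) \<in> measurable Q (count_space UNIV)"
    by (rule measurable_compose) simp
  then have "(\<lambda>w. if length hs < N then Some (Suc (length hs))
      else if real M * cmin N c \<le> left hs then Some (pick (S w)) else None)
      \<in> measurable Q (count_space UNIV)"
    by simp
  also have "(\<lambda>w. if length hs < N then Some (Suc (length hs))
      else if real M * cmin N c \<le> left hs then Some (pick (S w)) else None) = next_of u hs"
    by (rule ext) (simp add: next_arm_def Let_def S_def F_def g_def)
  finally show ?thesis .
qed

text \<open>Histories range over a countable type, so it suffices to treat each fixed value of the
  previous history separately.\<close>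

lemma measurable_hist:
  assumes "\<And>i j k. u i j k \<in> borel_measurable Q"
  shows "H u t \<in> measurable Q (count_space UNIV)"
proof (induction t)
  case (Suc t)
  have "(\<lambda>w. case next_of u hs w of None \<Rightarrow> hs | Some a \<Rightarrow> hs @ [a]) \<in> measurable Q (count_space UNIV)" for hs
    by (rule measurable_compose[OF measurable_next_of[OF assms]]) simp
  from measurable_compose_countable[OF this Suc] show ?case by simp
qed simp

lemma measurable_next_at:
  assumes "\<And>i j k. u i j k \<in> borel_measurable Q"
  shows "(\<lambda>w. next_at u t w) \<in> measurable Q (count_space UNIV)"
  using measurable_compose_countable[OF measurable_next_of[OF assms] measurable_hist[OF assms]] .

end

section \<open>Analytic and combinatorial inequalities\<close>

text \<open>Each round index contributes two deviation events of probability at most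
  \<open>1 / k^3\<close>. Weakening cubes to squares gives twice the Basel sum.\<close>

lemma sum_inverse_cubes_le: "(\<Sum>k=N..<n. 2 / real k ^ 3) \<le> pi\<^sup>2 / 3" if "1 \<le> N"
proof -
  have s: "(\<lambda>n. 1 / (real n + 1)\<^sup>2) sums (pi\<^sup>2 / 6)" using inverse_squares_sums by (simp add: add.commute)
  have "(\<Sum>k=N..<n. 2 / real k ^ 3) \<le> (\<Sum>k=1..<Suc n. 2 / (real k)\<^sup>2)"
  proof (rule order_trans)
    show "(\<Sum>k=N..<n. 2 / real k ^ 3) \<le> (\<Sum>k=N..<n. 2 / (real k)\<^sup>2)"
      using that by (intro sum_mono divide_left_mono power_increasing) auto
    show "(\<Sum>k=N..<n. 2 / (real k)\<^sup>2) \<le> (\<Sum>k=1..<Suc n. 2 / (real k)\<^sup>2)"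
      using that by (intro sum_mono2) auto
  qed
  also have "\<dots> = 2 * (\<Sum>k<n. 1 / (real k + 1)\<^sup>2)"
    unfolding sum_distrib_left by (rule sum.reindex_bij_witness[of _ Suc "\<lambda>k. k - 1"]) (auto simp: add.commute)
  also have "\<dots> \<le> 2 * (pi\<^sup>2 / 6)"
    using sum_le_suminf[OF sums_summable[OF s], of "{..<n}"] sums_unique[OF s] by simp
  finally show ?thesis by simp
qed

text \<open>\<open>x k\<close> is the per-user cost of the \<open>k\<close>-th selection, \<open>Gd\<close> the rounds in which the optimal arm
  is still affordable, \<open>Ot\<close> the suboptimal selections, and \<open>\<tau>\<close>, \<open>n\<close> the numbers of rounds of the
  algorithm and of the benchmark. If \<open>\<tau> < n\<close>, the saving on the cheap late rounds offsets their
  losses up to \<open>\<Sum> x k / cs \<le> 1\<close>; otherwise the late rounds up to \<open>n\<close> are counted directly.\<close>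

lemma path_loss_bound:
  fixes x :: "nat \<Rightarrow> real" and L l b cm cs :: real and \<tau> n :: nat and Gd Ot :: "nat \<Rightarrow> bool"
  assumes l: "0 \<le> l" "l \<le> L" and cs: "0 < cs" and cm: "0 \<le> cm"
    and pos: "\<And>k. k < \<tau> \<Longrightarrow> 0 < x k"
    and spent: "(\<Sum>k<\<tau>. x k) \<le> b"
    and stopped: "b - (\<Sum>k<\<tau>. x k) < cm"
    and bad: "\<And>k. k < \<tau> \<Longrightarrow> \<not> Gd k \<Longrightarrow> b - (\<Sum>j<k. x j) < cs"
    and n: "real n \<le> b / cs + 1"
  shows "L * real (n - \<tau>) + l * real (card {k. k < n \<and> k < \<tau> \<and> Ot k}) \<le>
    L * (1 + cm / cs + (\<Sum>k | k < \<tau> \<and> Gd k. max 0 (x k - cs) / cs))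
    + l * (1 + real (card {k. k < \<tau> \<and> Gd k \<and> Ot k}))"
proof -
  define S where "S = (\<Sum>k | k < \<tau> \<and> Gd k. max 0 (x k - cs) / cs)"
  define Bd where "Bd = {k. k < \<tau> \<and> \<not> Gd k}"
  have S0: "S \<ge> 0" unfolding S_def using cs by (intro sum_nonneg) auto
  have cmcs: "cm / cs \<ge> 0" using cs cm by simp
  have L0: "L \<ge> 0" using l by simp
  have [simp]: "finite Bd" by (simp add: Bd_def)
  let ?G = "{k. k < \<tau> \<and> Gd k \<and> Ot k}"
  have later_cost: "(\<Sum>k\<in>Bd. x k) \<le> cs"
  proof (cases "Bd = {}")
    case False
    \<comment> \<open>\<open>s\<close> is the first late round. Less than \<open>cs\<close> is left
      at that point, and all late rounds are paid from this remainder.\<close>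
    define s where "s = Min Bd"
    have s: "s \<in> Bd" "\<And>k. k \<in> Bd \<Longrightarrow> s \<le> k" using False by (auto simp: s_def)
    have "(\<Sum>k<s. x k) + (\<Sum>k\<in>Bd. x k) = (\<Sum>k\<in>{..<s} \<union> Bd. x k)"
      using s(2) by (subst sum.union_disjoint) force+
    also have "\<dots> \<le> (\<Sum>k<\<tau>. x k)"
      using s(1) pos by (intro sum_mono2) (auto simp: Bd_def intro: less_imp_le)
    finally show ?thesis using spent bad[of s] s(1) by (simp add: Bd_def)
  qed (use cs in simp)
  have small: "x k < cs" if "k \<in> Bd" for k
  proof -
    have "(\<Sum>j<k. x j) + x k = (\<Sum>j<Suc k. x j)" by simp
    also have "\<dots> \<le> (\<Sum>k<\<tau>. x k)"
      using that pos by (intro sum_mono2) (auto simp: Bd_def intro: less_imp_le)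
    finally show ?thesis using spent bad[of k] that by (simp add: Bd_def)
  qed
  have "L * real (n - \<tau>) + l * real (card {k. k < n \<and> k < \<tau> \<and> Ot k}) \<le>
    L * (1 + cm / cs + S) + l * (1 + real (card ?G))"
  proof (cases "\<tau> < n")
    case True
    have "{k. k < n \<and> k < \<tau> \<and> Ot k} \<subseteq> ?G \<union> Bd" by (auto simp: Bd_def)
    then have "card {k. k < n \<and> k < \<tau> \<and> Ot k} \<le> card (?G \<union> Bd)"
      by (intro card_mono) auto
    also have "\<dots> \<le> card ?G + card Bd" by (rule card_Un_le)
    finally have c1: "real (card {k. k < n \<and> k < \<tau> \<and> Ot k}) \<le> real (card ?G) + real (card Bd)"
      by linarith
    have split: "(\<Sum>k<\<tau>. (x k - cs) / cs) = (\<Sum>k | k < \<tau> \<and> Gd k. (x k - cs) / cs) + (\<Sum>k\<in>Bd. (x k - cs) / cs)"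
    proof -
      have "{..<\<tau>} = {k. k < \<tau> \<and> Gd k} \<union> Bd" by (auto simp: Bd_def)
      then show ?thesis by (simp, subst sum.union_disjoint) (auto simp: Bd_def)
    qed
    have le: "(\<Sum>k | k < \<tau> \<and> Gd k. (x k - cs) / cs) \<le> S"
      unfolding S_def using cs by (intro sum_mono divide_right_mono) auto
    have "(\<Sum>k<\<tau>. (x k - cs) / cs) = (\<Sum>k<\<tau>. x k) / cs - \<tau>"
      using cs by (simp add: sum_divide_distrib[symmetric] sum_subtractf diff_divide_distrib)
    moreover have "(b - cm) / cs \<le> (\<Sum>k<\<tau>. x k) / cs"
      using stopped cs by (intro divide_right_mono) auto
    \<comment> \<open>The benchmark has at most \<open>b / cs + 1\<close> rounds, and all of
      \<open>b\<close> except less than \<open>cm\<close> was spent in \<open>\<tau>\<close> rounds.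
      Missing rounds thus come from the accumulated excess of \<open>x k / cs\<close> over
      1.\<close>
    ultimately have "real n - \<tau> \<le> 1 + cm / cs + (\<Sum>k<\<tau>. (x k - cs) / cs)"
      using n by (simp add: diff_divide_distrib)
    also have "\<dots> \<le> 1 + cm / cs + S + (\<Sum>k\<in>Bd. (x k - cs) / cs)"
      using split le by simp
    finally have "L * (real n - \<tau>) \<le> L * (1 + cm / cs + S + (\<Sum>k\<in>Bd. (x k - cs) / cs))"
      using L0 by (rule mult_left_mono)
    \<comment> \<open>The late terms are negative by \<open>small\<close>, so the factor
      \<open>L\<close> may be lowered to \<open>l\<close>. Then \<open>- l * card Bd\<close> cancels
      the charge for late selections, and \<open>later_cost\<close> leaves at most
      \<open>l\<close>.\<close>
    moreover have "L * (\<Sum>k\<in>Bd. (x k - cs) / cs) \<le> l * (\<Sum>k\<in>Bd. (x k - cs) / cs)"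
      using l(2) cs small
      by (intro mult_right_mono_neg sum_nonpos) (auto intro!: divide_nonpos_pos intro: less_imp_le)
    moreover have "(\<Sum>k\<in>Bd. (x k - cs) / cs) = (\<Sum>k\<in>Bd. x k) / cs - card Bd"
      using cs by (simp add: sum_divide_distrib[symmetric] sum_subtractf diff_divide_distrib)
    moreover have "l * ((\<Sum>k\<in>Bd. x k) / cs) \<le> l * 1"
      using later_cost cs l(1) by (intro mult_left_mono) auto
    moreover have "l * real (card {k. k < n \<and> k < \<tau> \<and> Ot k}) \<le> l * (real (card ?G) + real (card Bd))"
      using c1 l(1) by (rule mult_left_mono)
    ultimately show ?thesis using True by (simp add: of_nat_diff algebra_simps)
  next
    case False
    have *: "real (card {k. k < n \<and> k < \<tau> \<and> Ot k}) \<le> real (card ?G) + 2 + S"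
    proof (cases "Bd = {}")
      case True
      then have "{k. k < n \<and> k < \<tau> \<and> Ot k} \<subseteq> ?G" by (auto simp: Bd_def)
      then have "card {k. k < n \<and> k < \<tau> \<and> Ot k} \<le> card ?G" by (intro card_mono) auto
      with S0 show ?thesis by linarith
    next
      case False
      \<comment> \<open>All rounds from the first late round \<open>s\<close> up to \<open>n\<close>
        are charged. Before \<open>s\<close> every round is in \<open>Gd\<close> and more than
        \<open>b - cs\<close> has been spent, so \<open>s\<close> cannot lie further than
        \<open>2 + S\<close> below \<open>n\<close>.\<close>
      define s where "s = Min Bd"
      have s: "s \<in> Bd" "\<And>k. k \<in> Bd \<Longrightarrow> s \<le> k" using False by (auto simp: s_def)
      have "{k. k < n \<and> k < \<tau> \<and> Ot k} \<subseteq> ?G \<union> {s..<n}"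
        using s(2) unfolding Bd_def by (auto; metis not_le)
      then have "card {k. k < n \<and> k < \<tau> \<and> Ot k} \<le> card (?G \<union> {s..<n})"
        by (intro card_mono) auto
      also have "\<dots> \<le> card ?G + (n - s)" using card_Un_le[of ?G "{s..<n}"] by simp
      finally have c1: "real (card {k. k < n \<and> k < \<tau> \<and> Ot k}) \<le> real (card ?G) + real (n - s)"
        by linarith
      have "(\<Sum>k<s. (x k - cs) / cs) \<le> (\<Sum>k<s. max 0 (x k - cs) / cs)"
        using cs by (intro sum_mono divide_right_mono) auto
      also have "\<dots> \<le> S" unfolding S_def
      proof (rule sum_mono2)
        show "{..<s} \<subseteq> {k. k < \<tau> \<and> Gd k}"
          using s unfolding Bd_def by (auto; metis not_le order_less_trans)
      qed (use cs in auto)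
      finally have "(\<Sum>k<s. x k) / cs - s \<le> S"
        using cs by (simp add: sum_divide_distrib[symmetric] sum_subtractf diff_divide_distrib)
      moreover have "(b - cs) / cs \<le> (\<Sum>k<s. x k) / cs"
        using bad[of s] s(1) cs by (intro divide_right_mono) (auto simp: Bd_def)
      ultimately have "real n - s \<le> 2 + S" using n cs by (simp add: diff_divide_distrib)
      then show ?thesis using c1 S0 by (cases "s \<le> n") auto
    qed
    have "l * real (card {k. k < n \<and> k < \<tau> \<and> Ot k}) \<le> l * (real (card ?G) + 2 + S)"
      using * l(1) by (rule mult_left_mono)
    \<comment> \<open>Of the surplus \<open>2 + S\<close>, one unit is the permitted extra
      \<open>l\<close>; the remaining \<open>1 + S\<close> is moved to the \<open>L\<close> term,
      which is free here because no round is missing.\<close>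
    moreover have "l * (1 + S) \<le> L * (1 + S)" using l(2) S0 by (intro mult_right_mono) auto
    moreover have "0 \<le> L * (cm / cs)" using L0 cmcs by (rule mult_nonneg_nonneg)
    ultimately show ?thesis using False by (simp add: algebra_simps)
  qed
  then show ?thesis by (simp add: S_def)
qed

text \<open>The UCB1 comparison passes through the logarithm without loss: as \<open>Ui\<close> is
  at least 1, \<open>ln\<close> grows by at most \<open>2 * r\<close> between \<open>Ui\<close> and
  \<open>Ui + 2 * r\<close>.\<close>

lemma log_index_gap:
  fixes ci cs Ui Us r v vs :: real
  assumes pos: "0 < ci" "0 < cs" and U: "1 \<le> Ui" "0 < Us" and r: "0 \<le> r"
    and v: "0 < v" "v \<le> Ui + 2 * r" and vs: "Us \<le> vs"
    and greedy: "ln vs / cs \<le> ln v / ci"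
  shows "ci * (ln Us / cs - ln Ui / ci) \<le> 2 * r"
proof -
  have "ln Us / cs \<le> ln vs / cs" using vs U pos by (intro divide_right_mono) auto
  also have "\<dots> \<le> ln v / ci" by fact
  also have "\<dots> \<le> ln (Ui + 2 * r) / ci" using v pos by (intro divide_right_mono) auto
  finally have "ci * (ln Us / cs - ln Ui / ci) \<le> ln (Ui + 2 * r) - ln Ui"
    using pos by (simp add: field_simps)
  also have "\<dots> = ln (1 + 2 * r / Ui)"
    using ln_div[of "Ui + 2 * r" Ui] U r by (simp add: add_divide_distrib)
  also have "\<dots> \<le> 2 * r / Ui" using U r by (intro ln_add_one_self_le_self) auto
  also have "\<dots> \<le> 2 * r" using U r by (simp add: divide_le_eq mult_le_cancel_left1)
  finally show ?thesis .
qed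

section \<open>Centred sums of the samples of one arm\<close>

text \<open>An unnormalised sum is used because it changes additively with each pull, as the
  exponential process below requires.\<close>

definition deviation ::
  "nat \<Rightarrow> (nat \<Rightarrow> nat \<Rightarrow> nat \<Rightarrow> 'a \<Rightarrow> real) \<Rightarrow> (nat \<Rightarrow> real) \<Rightarrow> nat list \<Rightarrow> nat \<Rightarrow> 'a \<Rightarrow> real" where
  "deviation M u U hs i w =
     (\<Sum>k\<in>{k. k < length hs \<and> hs ! k = i}. \<Sum>j=1..M. (u i j (Suc k) w - U i))"

lemma emp_mean_eq_deviation:
  assumes "0 < pulls hs i" "0 < M"
  shows "emp_mean M u hs i w = U i + deviation M u U hs i w / (real (pulls hs i) * real M)"
proof -
  have p: "pulls hs i = card {k. k < length hs \<and> hs ! k = i}"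
    by (simp add: pulls_def length_filter_conv_card)
  have "deviation M u U hs i w =
    (\<Sum>k\<in>{k. k < length hs \<and> hs ! k = i}. \<Sum>j=1..M. u i j (Suc k) w) - real (pulls hs i) * real M * U i"
    by (simp add: deviation_def sum_subtractf p)
  then show ?thesis using assms by (simp add: emp_mean_def field_simps)
qed

lemma deviation_snoc:
  "deviation M u U (hs @ [a]) i w = deviation M u U hs i w +
     (if a = i then \<Sum>j=1..M. (u i j (Suc (length hs)) w - U i) else 0)"
proof -
  let ?f = "\<lambda>k. \<Sum>j=1..M. (u i j (Suc k) w - U i)"
  have "{k. k < length (hs @ [a]) \<and> (hs @ [a]) ! k = i} =
    (if a = i then insert (length hs) {k. k < length hs \<and> hs ! k = i}
     else {k. k < length hs \<and> hs ! k = i})"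
    by (auto simp: nth_append less_Suc_eq)
  then show ?thesis unfolding deviation_def by simp
qed

section \<open>The stochastic model and the counting of suboptimal selections\<close>

locale bandit = budgeted_arms N M c B pick + prob_space P
  for N M :: nat and c :: "nat \<Rightarrow> real" and B :: real and pick :: "nat set \<Rightarrow> nat"
    and P :: "'a measure" +
  fixes U :: "nat \<Rightarrow> real" and umin umax :: real and istar :: nat
    and u :: "nat \<Rightarrow> nat \<Rightarrow> nat \<Rightarrow> 'a \<Rightarrow> real"
  assumes urange: "1 \<le> umin" "umin \<le> umax" "umax \<le> 2"
    and meas: "\<forall>i\<in>{1..N}. \<forall>j\<in>{1..M}. \<forall>t\<ge>1. u i j t \<in> borel_measurable P"
    and indep: "indep_vars (\<lambda>_. borel) (\<lambda>(i, j, t). u i j t) ({1..N} \<times> {1..M} \<times> {1..})"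
    and bounded: "\<forall>i\<in>{1..N}. \<forall>j\<in>{1..M}. \<forall>t\<ge>1. \<forall>w\<in>space P.
                    umin \<le> u i j t w \<and> u i j t w \<le> umax"
    and mean: "\<forall>i\<in>{1..N}. \<forall>j\<in>{1..M}. \<forall>t\<ge>1. (\<integral>w. u i j t w \<partial>P) = U i"
    and istar: "istar \<in> {1..N}"
    and istar_opt: "\<forall>i\<in>{1..N}. i \<noteq> istar \<longrightarrow> ln (U i) / c i < ln (U istar) / c istar"
begin

lemma U_bounds:
  assumes "i \<in> {1..N}"
  shows "umin \<le> U i" "U i \<le> umax"
proof -
  have b: "AE w in P. umin \<le> u i 1 1 w \<and> u i 1 1 w \<le> umax" using bounded assms M1 by simp
  have m: "u i 1 1 \<in> borel_measurable P" using meas assms M1 by simp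
  have int: "integrable P (u i 1 1)"
    by (rule integrable_const_bound[where B = umax, OF _ m], rule eventually_mono[OF b])
      (use urange in auto)
  have E: "(\<integral>w. u i 1 1 w \<partial>P) = U i" using mean assms M1 by simp
  show "umin \<le> U i" using integral_ge_const[OF int, of umin] b E by auto
  show "U i \<le> umax" using integral_le_const[OF int, of umax] b E by auto
qed

abbreviation "dev \<equiv> deviation M u U"

definition gap :: "nat \<Rightarrow> real" where
  "gap i = ln (U istar) / c istar - ln (U i) / c i"

text \<open>The UCB1 threshold with the logarithm of the round index replaced by that of its largest
  possible value.\<close>

definition cutoff :: "nat \<Rightarrow> real" where
  "cutoff i = 8 * ln (B / (real M * cmin N c)) / (real M * (c i)\<^sup>2 * (gap i)\<^sup>2)"

text \<open>The exploration bonus multiplied by the number of samples, to be compared with the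
  unnormalised \<open>dev\<close>.\<close>

definition slack :: "nat \<Rightarrow> nat \<Rightarrow> 'a \<Rightarrow> real" where
  "slack i k w = sqrt (2 * ln (real k) * (real (pulls (H u k w) i) * real M))"

text \<open>For an arm never pulled both \<open>slack\<close> and \<open>dev\<close> are 0 and the
  inequality would hold trivially; the positivity condition excludes this.\<close>

definition overestimated :: "nat \<Rightarrow> nat \<Rightarrow> 'a \<Rightarrow> bool" where
  "overestimated i k w \<longleftrightarrow> 0 < pulls (H u k w) i \<and> slack i k w \<le> dev (H u k w) i w"

definition underestimated :: "nat \<Rightarrow> nat \<Rightarrow> 'a \<Rightarrow> bool" where
  "underestimated i k w \<longleftrightarrow> 0 < pulls (H u k w) i \<and> slack i k w \<le> - dev (H u k w) i w"

lemma gap_pos: "i \<in> {1..N} \<Longrightarrow> i \<noteq> istar \<Longrightarrow> 0 < gap i"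
  using istar_opt by (simp add: gap_def)

lemma N_le_horizon_ratio: "real N \<le> B / (real M * cmin N c)"
proof -
  have "(\<Sum>i=1..N. cmin N c) \<le> (\<Sum>i=1..N. c i)" by (intro sum_mono cmin_le) auto
  then have "real M * (real N * cmin N c) \<le> real M * (\<Sum>i=1..N. c i)" using Mpos by simp
  then have "real N * (real M * cmin N c) \<le> B" using Blarge by (simp add: mult_ac)
  then show ?thesis using Mpos cmin_pos by (simp add: pos_le_divide_eq)
qed

lemma cutoff_nonneg: "0 \<le> cutoff i"
  unfolding cutoff_def using N_le_horizon_ratio N2 Mpos by (intro divide_nonneg_nonneg) auto

lemma pulls_pos_after_init:
  assumes "N \<le> k" "i \<in> {1..N}"
  shows "0 < pulls (H u k w) i"
proof -
  have "set (H u N w) \<subseteq> set (H u k w)"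
    using assms(1) by (induction k rule: dec_induct) (auto split: option.splits)
  moreover have "i \<in> set (H u N w)" using assms(2) by (subst hist_initial) auto
  ultimately show ?thesis by (auto simp: pulls_pos_iff)
qed

text \<open>Without deviations the index of \<open>istar\<close> is at least \<open>U istar\<close>
  and that of \<open>i\<close> at most \<open>U i\<close> plus twice the bonus, so preferring
  \<open>i\<close> forces the bonus to be large and the pulls to be few. The preference can be read
  off only if \<open>istar\<close> is affordable, as the argmax ranges over affordable arms.\<close>

lemma few_pulls:
  assumes w: "w \<in> space P" and nxt: "next_at u k w = Some i" and i: "i \<noteq> istar"
    and k: "N \<le> k" and aff: "real M * c istar \<le> left (H u k w)"
    and conc: "\<not> overestimated i k w" "\<not> underestimated istar k w"
  shows "real (pulls (H u k w) i) \<le> cutoff i"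
proof -
  define s where "s = real (pulls (H u k w) i) * real M"
  define s' where "s' = real (pulls (H u k w) istar) * real M"
  define r where "r = sqrt (2 * ln (real k) / s)"
  have iN: "i \<in> {1..N}" using next_at_range[OF nxt] .
  have ppos: "0 < pulls (H u k w) i" "0 < pulls (H u k w) istar"
    using pulls_pos_after_init[OF k] iN istar by auto
  then have spos: "s > 0" "s' > 0" using Mpos by (auto simp: s_def s'_def)
  have len: "length (H u k w) = k" using length_hist[of u k w] nxt by simp
  have lnk: "ln (real k) > 0" using k N2 by simp
  have rpos: "r > 0" using lnk spos by (simp add: r_def)
  have sr: "sqrt (2 * ln (real k) * x) = x * sqrt (2 * ln (real k) / x)" if "x > 0" for x
  proof -
    have "2 * ln (real k) * x = x\<^sup>2 * (2 * ln (real k) / x)" using that by (simp add: power2_eq_square)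
    then show ?thesis using that by (simp only: real_sqrt_mult) simp
  qed
  have "dev (H u k w) i w < s * r"
    using conc(1) ppos sr[OF spos(1)] by (simp add: overestimated_def slack_def s_def r_def)
  then have "dev (H u k w) i w / s < r" using spos by (simp add: divide_less_eq mult_ac)
  then have v: "ucb_index M u (H u k w) i w \<le> U i + 2 * r"
    unfolding ucb_index_def using emp_mean_eq_deviation[of "H u k w" i M u w U] ppos M1
    by (simp add: len s_def r_def)
  define r' where "r' = sqrt (2 * ln (real k) / s')"
  have "- dev (H u k w) istar w < s' * r'"
    using conc(2) ppos sr[OF spos(2)] by (simp add: underestimated_def slack_def s'_def r'_def)
  then have "- dev (H u k w) istar w / s' < r'"
    using spos by (subst pos_divide_less_eq) (auto simp: mult_ac)
  then have vs: "U istar \<le> ucb_index M u (H u k w) istar w"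
    unfolding ucb_index_def using emp_mean_eq_deviation[of "H u k w" istar M u w U] ppos M1
    by (simp add: len s'_def r'_def)
  have "emp_mean M u (H u k w) i w \<ge> 0"
    unfolding emp_mean_def using bounded w iN urange
    by (intro divide_nonneg_nonneg sum_nonneg) (force intro: order_trans[of 0 umin])+
  then have vpos: "ucb_index M u (H u k w) i w > 0"
    unfolding ucb_index_def using rpos by (simp add: len s_def r_def add_nonneg_pos)
  have "c i * gap i \<le> 2 * r"
    unfolding gap_def
    using log_index_gap[OF _ _ _ _ _ vpos v vs, of "c i" "c istar"] rpos cpos iN istar U_bounds[OF iN]
      U_bounds[OF istar] urange next_of_greedy(3)[OF _ nxt istar aff] len k by force
  then have "(c i * gap i)\<^sup>2 \<le> (2 * r)\<^sup>2"
    using gap_pos[OF iN i] cpos iN by (intro power_mono) (auto intro: less_imp_le)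
  \<comment> \<open>The constant 8 is the square of the factor 2 before \<open>r\<close>, times the
    2 under the root in the bonus.\<close>
  also have "\<dots> = 8 * ln (real k) / s" using lnk spos by (simp add: r_def power_mult_distrib)
  finally have "s * (c i * gap i)\<^sup>2 \<le> 8 * ln (real k)" using spos by (simp add: field_simps)
  \<comment> \<open>Round \<open>k + 1\<close> is played, so \<open>k\<close> lies below the horizon
    ratio and its logarithm below a deterministic one.\<close>
  also have "real k \<le> B / (real M * cmin N c)"
    using Suc_le_of_active[OF nxt] by simp
  then have "8 * ln (real k) \<le> 8 * ln (B / (real M * cmin N c))" using k N2 by simp
  finally have "real (pulls (H u k w) i) * (real M * (c i)\<^sup>2 * (gap i)\<^sup>2) \<le> 8 * ln (B / (real M * cmin N c))"
    by (simp add: s_def power_mult_distrib mult_ac)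
  moreover have "real M * (c i)\<^sup>2 * (gap i)\<^sup>2 > 0"
  proof -
    have "c i > 0" using cpos iN by blast
    then show ?thesis using gap_pos[OF iN i] Mpos by simp
  qed
  ultimately show ?thesis unfolding cutoff_def by (simp add: pos_le_divide_eq)
qed

text \<open>The rounds whose suboptimal selections can be counted: initial rounds, where the chosen
  arm has no earlier pull, and rounds where the comparison with \<open>istar\<close> is
  available.\<close>

definition regular :: "nat \<Rightarrow> 'a \<Rightarrow> bool" where
  "regular k w \<longleftrightarrow> k < N \<or> real M * c istar \<le> left (H u k w)"

lemma pulls_mono: "s \<le> t \<Longrightarrow> pulls (H u s w) i \<le> pulls (H u t w) i"
proof (induction t rule: dec_induct)
  case (step n)
  then show ?case by (auto simp: pulls_snoc split: option.splits)
qed simp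

lemma pulls_Suc: "next_at u k w = Some i \<Longrightarrow> pulls (H u (Suc k) w) i = Suc (pulls (H u k w) i)"
  by (simp add: pulls_snoc)

text \<open>Each selection of \<open>i\<close> raises its pull count, so the counts just before the
  selections are distinct naturals up to \<open>x\<close>. The extra 1 accounts for the count
  0.\<close>

lemma card_le_pulls_bound:
  assumes "0 \<le> x"
  shows "real (card {k. k < T \<and> next_at u k w = Some i \<and> real (pulls (H u k w) i) \<le> x}) \<le> x + 1"
proof -
  let ?S = "{k. k < T \<and> next_at u k w = Some i \<and> real (pulls (H u k w) i) \<le> x}"
  have inj: "inj_on (\<lambda>k. pulls (H u k w) i) ?S"
  proof (rule linorder_inj_onI)
    fix k l assume "k < l" "k \<in> ?S" "l \<in> ?S"
    then have "Suc (pulls (H u k w) i) \<le> pulls (H u l w) i"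
      using pulls_mono[of "Suc k" l w i] pulls_Suc[of k w i] by simp
    then show "pulls (H u k w) i \<noteq> pulls (H u l w) i" by simp
  qed auto
  have "(\<lambda>k. pulls (H u k w) i) ` ?S \<subseteq> {..nat \<lfloor>x\<rfloor>}" by (auto simp: le_nat_floor)
  then have "card ?S \<le> card {..nat \<lfloor>x\<rfloor>}" by (intro card_inj_on_le[OF inj]) auto
  then have "card ?S \<le> Suc (nat \<lfloor>x\<rfloor>)" by simp
  then show ?thesis using assms by linarith
qed

lemma regular_pulls_bound:
  assumes w: "w \<in> space P" and i: "i \<in> {1..N}" "i \<noteq> istar"
  shows "real (card {k. k < horizon \<and> next_at u k w = Some i \<and> regular k w}) \<le>
    cutoff i + 1 + (\<Sum>k=N..<horizon. of_bool (overestimated i k w) + of_bool (underestimated istar k w))"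
proof -
  let ?F = "{k. k < horizon \<and> next_at u k w = Some i \<and> real (pulls (H u k w) i) \<le> cutoff i}"
  let ?b = "\<lambda>k. overestimated i k w \<or> underestimated istar k w"
  have "{k. k < horizon \<and> next_at u k w = Some i \<and> regular k w} \<subseteq> ?F \<union> {k\<in>{N..<horizon}. ?b k}"
  proof
    fix k assume k: "k \<in> {k. k < horizon \<and> next_at u k w = Some i \<and> regular k w}"
    show "k \<in> ?F \<union> {k\<in>{N..<horizon}. ?b k}"
    proof (cases "k < N")
      \<comment> \<open>Round \<open>k + 1\<close> is the first visit to arm \<open>k + 1\<close>,
        so its count 0 is below the cutoff.\<close>
      case True
      then have h: "H u k w = [1..<Suc k]" by (intro hist_initial) simp
      then have "length (H u k w) < N" using True by (simp del: upt_Suc)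
      then have "i = Suc k" using k next_of_initial[of "H u k w" u w] h by (simp del: upt_Suc)
      then have "i \<notin> set (H u k w)" using h by simp
      then have "pulls (H u k w) i = 0" using pulls_pos_iff[of "H u k w" i] by simp
      then show ?thesis using k cutoff_nonneg[of i] by simp
    next
      case False
      then show ?thesis using k few_pulls[OF w, of k i] i by (auto simp: regular_def)
    qed
  qed
  then have "card {k. k < horizon \<and> next_at u k w = Some i \<and> regular k w} \<le>
      card (?F \<union> {k\<in>{N..<horizon}. ?b k})"
    by (intro card_mono) auto
  also have "\<dots> \<le> card ?F + card {k\<in>{N..<horizon}. ?b k}" by (rule card_Un_le)
  finally have "real (card {k. k < horizon \<and> next_at u k w = Some i \<and> regular k w})
      \<le> real (card ?F) + real (card {k\<in>{N..<horizon}. ?b k})"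
    by linarith
  also have "real (card ?F) \<le> cutoff i + 1" by (rule card_le_pulls_bound[OF cutoff_nonneg])
  also have "real (card {k\<in>{N..<horizon}. ?b k}) = (\<Sum>k=N..<horizon. of_bool (?b k))"
  proof -
    have "{N..<horizon} \<inter> {k. ?b k} = {k\<in>{N..<horizon}. ?b k}" by auto
    then show ?thesis by (simp only: sum_of_bool_eq finite_atLeastLessThan)
  qed
  also have "\<dots> \<le> (\<Sum>k=N..<horizon. of_bool (overestimated i k w) + of_bool (underestimated istar k w))"
    by (intro sum_mono) auto
  finally show ?thesis by simp
qed

section \<open>Independence of a round from the past\<close>

text \<open>All arms are included, chosen or not, so that the index set is deterministic although
  the run decides which values are revealed.\<close>

definition past :: "nat \<Rightarrow> (nat \<times> nat \<times> nat) set" where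
  "past t = {1..N} \<times> {1..M} \<times> {1..t}"

definition obs :: "'a \<Rightarrow> nat \<times> nat \<times> nat \<Rightarrow> real" where
  "obs w = (\<lambda>(i, j, k). u i j k w)"

text \<open>Since the history at time \<open>t\<close> only queries \<open>u\<close> at indices in \<open>past t\<close>, running the algorithm
  on the coordinate functions of the product space exhibits it as a measurable function of these
  finitely many observations, which are independent of the later ones.\<close>

lemma factor_through_past:
  fixes G :: "nat list \<Rightarrow> nat option \<Rightarrow> real \<Rightarrow> real"
  assumes G: "\<And>hs a. G hs a \<in> borel_measurable borel" and i: "i \<in> {1..N}"
  obtains F where "F \<in> borel_measurable (PiM (past t) (\<lambda>_. borel))"
    "\<And>w. G (H u t w) (next_at u t w) (dev (H u t w) i w) = F (restrict (obs w) (past t))"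
proof
  \<comment> \<open>Coordinates outside \<open>past t\<close> do not belong to the product space.
    The default 0 keeps \<open>v\<close> measurable at every index and is never read by the run up
    to time \<open>t\<close>.\<close>
  define v :: "nat \<Rightarrow> nat \<Rightarrow> nat \<Rightarrow> (nat \<times> nat \<times> nat \<Rightarrow> real) \<Rightarrow> real"
    where "v = (\<lambda>i j k x. if (i, j, k) \<in> past t then x (i, j, k) else 0)"
  define F where "F = (\<lambda>x. G (H v t x) (next_at v t x) (deviation M v U (H v t x) i x))"
  let ?Q = "PiM (past t) (\<lambda>_. borel :: real measure)"
  have v[measurable]: "v i j k \<in> borel_measurable ?Q" for i j k
    by (cases "(i, j, k) \<in> past t") (auto simp: v_def)
  have "(\<lambda>x. deviation M v U hs i x) \<in> borel_measurable ?Q" for hs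
    unfolding deviation_def by measurable
  then have "(\<lambda>x. G hs a (deviation M v U hs i x)) \<in> borel_measurable ?Q" for hs a
    using G by (rule measurable_compose)
  from measurable_compose_countable[OF this measurable_next_at[of v, OF v]]
  have "(\<lambda>x. G hs (next_at v t x) (deviation M v U hs i x)) \<in> borel_measurable ?Q" for hs .
  from measurable_compose_countable[OF this measurable_hist[of v, OF v]]
  show "F \<in> borel_measurable ?Q" unfolding F_def .
  fix w
  let ?x = "restrict (obs w) (past t)"
  have eq: "u i j k w = v i j k ?x" if "i \<in> {1..N}" "j \<in> {1..M}" "k \<in> {1..t}" for i j k
    using that by (auto simp: v_def past_def obs_def)
  have h: "H u t w = H v t ?x" by (rule hist_cong) (rule eq)
  have n: "next_at u t w = next_at v t ?x" by (rule next_at_cong) (rule eq)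
  have d: "dev (H u t w) i w = deviation M v U (H u t w) i ?x"
    unfolding deviation_def using eq i length_hist_le[of u t w]
    by (intro sum.cong refl arg_cong2[where f = "(-)"]) auto
  show "G (H u t w) (next_at u t w) (dev (H u t w) i w) = F ?x"
    by (simp only: F_def n d) (simp only: h)
qed

lemma past_subset: "past t \<subseteq> {1..N} \<times> {1..M} \<times> {1..}"
  by (auto simp: past_def)

lemma indep_obs: "indep_vars (\<lambda>_. borel) (\<lambda>p w. obs w p) ({1..N} \<times> {1..M} \<times> {1..})"
proof -
  have "(\<lambda>p w. obs w p) = (\<lambda>(i, j, t). u i j t)" by (auto simp: obs_def fun_eq_iff)
  with indep show ?thesis by simp
qed

text \<open>The choice for round \<open>t + 1\<close> is already a function of
  \<open>past t\<close>, which is disjoint from the block \<open>A\<close> of values of arm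
  \<open>i\<close> in round \<open>t + 1\<close>. The generic \<open>G\<close> covers history, next
  choice and deviation at once.\<close>

lemma indep_past_next_round:
  fixes G :: "nat list \<Rightarrow> nat option \<Rightarrow> real \<Rightarrow> real"
  assumes G: "\<And>hs a. G hs a \<in> borel_measurable borel" and i: "i \<in> {1..N}"
    and \<phi>: "\<phi> \<in> borel_measurable borel"
  shows "indep_var borel (\<lambda>w. G (H u t w) (next_at u t w) (dev (H u t w) i w))
    borel (\<lambda>w. \<phi> (\<Sum>j=1..M. u i j (Suc t) w))"
proof -
  obtain F where F: "F \<in> borel_measurable (PiM (past t) (\<lambda>_. borel))"
    "\<And>w. G (H u t w) (next_at u t w) (dev (H u t w) i w) = F (restrict (obs w) (past t))"
    using factor_through_past[where G = G, OF G i] by metis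
  define A where "A = {i} \<times> {1..M} \<times> {Suc t}"
  define F' where "F' = (\<lambda>x. \<phi> (\<Sum>j=1..M. x (i, j, Suc t)))"
  have "(\<lambda>x. \<Sum>j=1..M. x (i, j, Suc t)) \<in> borel_measurable (PiM A (\<lambda>_. borel :: real measure))"
    by (intro borel_measurable_sum measurable_component_singleton) (auto simp: A_def)
  then have F': "F' \<in> borel_measurable (PiM A (\<lambda>_. borel))"
    unfolding F'_def using \<phi> by (rule measurable_compose)
  have "past t \<inter> A = {}" "A \<subseteq> {1..N} \<times> {1..M} \<times> {1..}"
    using i by (auto simp: past_def A_def)
  from indep_var_compose[OF indep_var_restrict[OF indep_obs this(1) past_subset this(2)] F(1) F']
  have "indep_var borel (\<lambda>w. F (restrict (obs w) (past t))) borel (\<lambda>w. F' (restrict (obs w) A))"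
    by (simp add: comp_def)
  moreover have "F' (restrict (obs w) A) = \<phi> (\<Sum>j=1..M. u i j (Suc t) w)" for w
    unfolding F'_def by (intro arg_cong[where f = \<phi>] sum.cong) (auto simp: A_def obs_def)
  ultimately show ?thesis by (simp add: F(2))
qed

lemma measurable_past:
  fixes G :: "nat list \<Rightarrow> nat option \<Rightarrow> real \<Rightarrow> real"
  assumes "\<And>hs a. G hs a \<in> borel_measurable borel" and "i \<in> {1..N}"
  shows "(\<lambda>w. G (H u t w) (next_at u t w) (dev (H u t w) i w)) \<in> borel_measurable P"
  using indep_var_rv1[OF indep_past_next_round[where G = G, OF assms, of "\<lambda>x. x"]] by simp

section \<open>Exponential moments and deviation probabilities\<close>

text \<open>Hoeffding's lemma for an interval of length at most 1, carried over from the nonnegative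
  integral to \<open>expectation\<close>.\<close>

lemma mgf_le_pos:
  fixes X :: "'a \<Rightarrow> real"
  assumes X: "X \<in> borel_measurable P" "\<And>w. w \<in> space P \<Longrightarrow> a \<le> X w \<and> X w \<le> b"
    and "b - a \<le> 1" "0 < l"
  shows "expectation (\<lambda>w. exp (l * (X w - expectation X))) \<le> exp (l\<^sup>2 / 8)"
proof -
  interpret X: interval_bounded_random_variable P X a b
    by unfold_locales (use X in auto)
  have ab: "a \<le> b" using X(2) not_empty by force
  have "ennreal (expectation (\<lambda>w. exp (l * (X w - expectation X)))) =
    (\<integral>\<^sup>+w. ennreal (exp (l * (X w - expectation X))) \<partial>P)"
  proof (rule nn_integral_eq_integral[symmetric])
    show "integrable P (\<lambda>w. exp (l * (X w - expectation X)))"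
    proof (rule integrable_const_bound[where B = "exp (l * (b - expectation X))"])
      show "AE w in P. norm (exp (l * (X w - expectation X))) \<le> exp (l * (b - expectation X))"
        using X(2) \<open>0 < l\<close> by (intro AE_I2) auto
    qed (use X(1) in measurable)
  qed auto
  also have "\<dots> \<le> ennreal (exp (l\<^sup>2 * (b - a)\<^sup>2 / 8))"
    by (rule X.Hoeffdings_lemma_nn_integral[OF \<open>0 < l\<close>])
  also have "(b - a)\<^sup>2 \<le> 1" using ab assms(3) by (simp add: power_le_one)
  then have "ennreal (exp (l\<^sup>2 * (b - a)\<^sup>2 / 8)) \<le> ennreal (exp (l\<^sup>2 / 8))"
    by (intro ennreal_leI) (simp add: mult_left_le)
  finally show ?thesis by (simp add: ennreal_le_iff)
qed

text \<open>Upper and lower tails need both signs of \<open>l\<close>; a negative \<open>l\<close>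
  is reduced to a positive one by reflecting \<open>X\<close>.\<close>

lemma mgf_le:
  fixes X :: "'a \<Rightarrow> real"
  assumes X: "X \<in> borel_measurable P" "\<And>w. w \<in> space P \<Longrightarrow> a \<le> X w \<and> X w \<le> b"
    and ab: "b - a \<le> 1"
  shows "expectation (\<lambda>w. exp (l * (X w - expectation X))) \<le> exp (l\<^sup>2 / 8)"
proof -
  consider "l > 0" | "l = 0" | "l < 0" by linarith
  then show ?thesis
  proof cases
    case 1 with mgf_le_pos[OF assms] show ?thesis by simp
  next
    case 2 then show ?thesis by (simp add: prob_space)
  next
    case 3
    have "expectation (\<lambda>w. exp (- l * (- X w - expectation (\<lambda>w. - X w)))) \<le> exp ((- l)\<^sup>2 / 8)"
      by (rule mgf_le_pos[of _ "- b" "- a"]) (use X ab 3 in auto)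
    then show ?thesis by (simp add: algebra_simps)
  qed
qed

text \<open>\<open>Y\<close> is the factor gained by the exponential process at one pull. It is a
  product of \<open>M\<close> independent factors, each normalised by Hoeffding's lemma to mean at
  most 1.\<close>

lemma round_mgf:
  fixes l :: real
  assumes i: "i \<in> {1..N}" and t: "1 \<le> t"
  defines "Y \<equiv> \<lambda>w. exp (l * ((\<Sum>j=1..M. u i j t w) - real M * U i) - l\<^sup>2 * real M / 8)"
  shows "integrable P Y" "expectation Y \<le> 1"
proof -
  define J where "J = (\<lambda>j. (i, j, t)) ` {1..M}"
  define Z where "Z = (\<lambda>p w. exp (l * (obs w p - U i) - l\<^sup>2 / 8))"
  have JI: "J \<subseteq> {1..N} \<times> {1..M} \<times> {1..}" using i t by (auto simp: J_def)
  have finJ: "finite J" by (simp add: J_def)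
  have indZ: "indep_vars (\<lambda>_. borel) Z J"
    unfolding Z_def by (rule indep_vars_compose2[OF indep_vars_subset[OF indep_obs JI]]) simp
  have u: "u i j t \<in> borel_measurable P" "\<And>w. w \<in> space P \<Longrightarrow> umin \<le> u i j t w \<and> u i j t w \<le> umax"
      "expectation (u i j t) = U i" if "j \<in> {1..M}" for j
    using that i t meas bounded mean by auto
  have intZ: "integrable P (Z p)" and EZ: "expectation (Z p) \<le> 1" if p: "p \<in> J" for p
  proof -
    obtain j where j: "j \<in> {1..M}" "p = (i, j, t)" using p by (auto simp: J_def)
    note [measurable] = u(1)[OF j(1)]
    have Zp: "Z p = (\<lambda>w. exp (l * (u i j t w - U i)) * exp (- l\<^sup>2 / 8))"
      by (simp add: Z_def j obs_def exp_add[symmetric])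
    show "integrable P (Z p)" unfolding Zp
    proof (rule integrable_const_bound)
      show "AE w in P. norm (exp (l * (u i j t w - U i)) * exp (- l\<^sup>2 / 8)) \<le> exp \<bar>l\<bar> * exp (- l\<^sup>2 / 8)"
      proof (rule AE_I2)
        fix w assume "w \<in> space P"
        then have "\<bar>u i j t w - U i\<bar> \<le> 1" using u(2)[OF j(1)] U_bounds[OF i] urange by force
        then have "\<bar>l * (u i j t w - U i)\<bar> \<le> \<bar>l\<bar>" by (simp add: abs_mult mult_left_le)
        then have "l * (u i j t w - U i) \<le> \<bar>l\<bar>" by linarith
        then show "norm (exp (l * (u i j t w - U i)) * exp (- l\<^sup>2 / 8)) \<le> exp \<bar>l\<bar> * exp (- l\<^sup>2 / 8)"
          by simp
      qed
    qed simp
    have "expectation (\<lambda>w. exp (l * (u i j t w - U i))) \<le> exp (l\<^sup>2 / 8)"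
      using mgf_le[OF u(1,2)[OF j(1)], of l] u(3)[OF j(1)] urange by simp
    then have "expectation (\<lambda>w. exp (l * (u i j t w - U i))) * exp (- l\<^sup>2 / 8) \<le> exp (l\<^sup>2 / 8) * exp (- l\<^sup>2 / 8)"
      by (rule mult_right_mono) simp
    also have "\<dots> = 1" by (simp add: exp_add[symmetric])
    finally show "expectation (Z p) \<le> 1" by (simp add: Zp)
  qed
  have Y: "Y = (\<lambda>w. \<Prod>p\<in>J. Z p w)"
  proof
    fix w
    have "(\<Prod>p\<in>J. Z p w) = (\<Prod>j=1..M. Z (i, j, t) w)"
      unfolding J_def by (subst prod.reindex) (auto simp: inj_on_def)
    also have "\<dots> = exp (\<Sum>j=1..M. l * (u i j t w - U i) - l\<^sup>2 / 8)"
      by (simp add: Z_def obs_def exp_sum)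
    also have "\<dots> = Y w"
      by (simp add: Y_def sum_subtractf sum_distrib_left[symmetric])
    finally show "Y w = (\<Prod>p\<in>J. Z p w)" by simp
  qed
  show "integrable P Y" unfolding Y by (rule indep_vars_integrable[OF finJ indZ intZ])
  have "expectation Y = (\<Prod>p\<in>J. expectation (Z p))"
    unfolding Y by (rule indep_vars_lebesgue_integral[OF finJ indZ intZ])
  also have "\<dots> \<le> 1"
    by (intro prod_le_1 conjI EZ Bochner_Integration.integral_nonneg) (auto simp: Z_def)
  finally show "expectation Y \<le> 1" .
qed

text \<open>The Chernoff exponential of the deviation. Its compensator runs with the pulls of arm
  \<open>i\<close>, not with time, so adaptive sampling is allowed.\<close>

definition expo :: "real \<Rightarrow> nat \<Rightarrow> nat \<Rightarrow> 'a \<Rightarrow> real" where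
  "expo l i t w = exp (l * dev (H u t w) i w - l\<^sup>2 * real M / 8 * real (pulls (H u t w) i))"

text \<open>The process changes only when arm \<open>i\<close> is chosen. That event depends on the
  past, while the factor gained is independent of the past and has mean at most 1.\<close>

lemma expo_supermartingale:
  assumes i: "i \<in> {1..N}"
  shows "integrable P (expo l i t) \<and> expectation (expo l i t) \<le> 1"
proof (induction t)
  case 0
  then show ?case by (simp add: expo_def[abs_def] deviation_def pulls_def prob_space)
next
  case (Suc t)
  define G where "G = (\<lambda>hs a d. of_bool (a = Some i) * exp (l * d - l\<^sup>2 * real M / 8 * real (pulls hs i)))"
  define X where "X = (\<lambda>w. of_bool (next_at u t w = Some i) * expo l i t w)"
  define \<phi> where "\<phi> = (\<lambda>x. exp (l * (x - real M * U i) - l\<^sup>2 * real M / 8))"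
  define Y where "Y = (\<lambda>w. \<phi> (\<Sum>j=1..M. u i j (Suc t) w))"
  have G: "G hs a \<in> borel_measurable borel" for hs a unfolding G_def by measurable
  have \<phi>: "\<phi> \<in> borel_measurable borel" unfolding \<phi>_def by measurable
  have XG: "X = (\<lambda>w. G (H u t w) (next_at u t w) (dev (H u t w) i w))"
    by (simp add: X_def G_def expo_def fun_eq_iff)
  have ind: "indep_var borel X borel Y"
    unfolding XG Y_def by (rule indep_past_next_round[OF G i \<phi>])
  have intY: "integrable P Y" and EY: "expectation Y \<le> 1"
    unfolding Y_def \<phi>_def using round_mgf[OF i, of "Suc t" l] by auto
  have intX: "integrable P X"
  proof (rule Bochner_Integration.integrable_bound)
    show "integrable P (expo l i t)" using Suc by simp
    show "X \<in> borel_measurable P" unfolding XG by (rule measurable_past[OF G i])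
    show "AE w in P. norm (X w) \<le> norm (expo l i t w)" by (auto simp: X_def)
  qed
  have X0: "expectation X \<ge> 0"
    by (intro Bochner_Integration.integral_nonneg) (auto simp: X_def expo_def)
  \<comment> \<open>\<open>X\<close> is the part of the process on the event that arm
    \<open>i\<close> is pulled next; only this part is multiplied by \<open>Y\<close>.\<close>
  have step: "expo l i (Suc t) = (\<lambda>w. expo l i t w - X w + X w * Y w)"
  proof
    fix w
    show "expo l i (Suc t) w = expo l i t w - X w + X w * Y w"
    proof (cases "next_at u t w")
      case None
      then show ?thesis by (simp add: expo_def X_def)
    next
      case (Some a)
      have len: "length (H u t w) = t" using length_hist[of u t w] Some by simp
      show ?thesis
      proof (cases "a = i")
        case False
        then show ?thesis using Some by (simp add: expo_def X_def deviation_snoc pulls_snoc)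
      next
        case True
        have "expo l i (Suc t) w = expo l i t w * Y w"
          using Some True
          by (simp add: expo_def Y_def \<phi>_def deviation_snoc pulls_snoc len exp_add[symmetric]
              sum_subtractf algebra_simps add_divide_distrib)
        then show ?thesis using Some True by (simp add: X_def)
      qed
    qed
  qed
  have intXY: "integrable P (\<lambda>w. X w * Y w)" by (rule indep_var_integrable[OF ind intX intY])
  have "expectation (\<lambda>w. X w * Y w) = expectation X * expectation Y"
    by (rule indep_var_lebesgue_integral[OF ind intX intY])
  also have "\<dots> \<le> expectation X" using EY X0 by (simp add: mult_left_le)
  finally have "expectation (expo l i (Suc t)) \<le> expectation (expo l i t)"
    using Suc intX intXY by (simp add: step)
  moreover have "integrable P (expo l i (Suc t))"
    using Suc intX intXY by (simp add: step)
  ultimately show ?case using Suc by simp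
qed

text \<open>The best exponent depends on the random number of pulls, so a union bound over its
  possible values \<open>s\<close> is taken: \<open>k\<close> values, each contributing at most
  \<open>1 / k^4\<close>. The sign \<open>\<sigma>\<close> treats both tails together.\<close>

lemma deviation_event_prob:
  fixes \<sigma> :: real
  assumes i: "i \<in> {1..N}" and k: "1 \<le> k" and \<sigma>: "\<sigma> = 1 \<or> \<sigma> = - 1"
  defines "E \<equiv> \<lambda>w. of_bool (0 < pulls (H u k w) i \<and> slack i k w \<le> \<sigma> * dev (H u k w) i w) :: real"
  shows "integrable P E" "expectation E \<le> 1 / real k ^ 3"
proof -
  define G where "G = (\<lambda>hs (a :: nat option) d. of_bool (0 < pulls hs i \<and>
      sqrt (2 * ln (real k) * (real (pulls hs i) * real M)) \<le> \<sigma> * d) :: real)"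
  have G: "G hs a \<in> borel_measurable borel" for hs a unfolding G_def by measurable
  have EG: "E = (\<lambda>w. G (H u k w) (next_at u k w) (dev (H u k w) i w))"
    by (simp add: E_def G_def slack_def)
  have "E \<in> borel_measurable P" unfolding EG by (rule measurable_past[OF G i])
  then show intE: "integrable P E" by (rule integrable_const_bound[where B = 1, rotated]) (auto simp: E_def)
  \<comment> \<open>With \<open>m\<close> samples and threshold \<open>a\<close>, the minimiser of
    \<open>l\<^sup>2 * m / 8 - l * a\<close> is \<open>4 * a / m\<close>. Here it yields the
    exponent \<open>8 ln k - 4 ln k = 4 ln k\<close>.\<close>
  define l where "l = (\<lambda>s::nat. \<sigma> * (4 * sqrt (2 * ln (real k) * (real s * real M)) / (real s * real M)))"
  have \<sigma>2: "\<sigma> * \<sigma> = 1" using \<sigma> by auto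
  \<comment> \<open>Only the summand whose \<open>s\<close> is the actual pull count is used; the
    others are nonnegative.\<close>
  have "E w \<le> (\<Sum>s=1..k. expo (l s) i k w / real k ^ 4)" for w
  proof (cases "0 < pulls (H u k w) i \<and> slack i k w \<le> \<sigma> * dev (H u k w) i w")
    case True
    define s where "s = pulls (H u k w) i"
    define m where "m = real s * real M"
    define a where "a = sqrt (2 * ln (real k) * m)"
    have s: "s \<in> {1..k}" using True pulls_le_length[of "H u k w" i] length_hist_le[of u k w]
      by (auto simp: s_def)
    have m: "m > 0" using s Mpos by (simp add: m_def)
    have a2: "a\<^sup>2 = 2 * ln (real k) * m" using k m by (simp add: a_def)
    have "a \<le> \<sigma> * dev (H u k w) i w" using True by (simp add: slack_def a_def m_def s_def)
    then have "4 * a / m * a \<le> 4 * a / m * (\<sigma> * dev (H u k w) i w)"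
      using m k by (intro mult_left_mono) (auto simp: a_def)
    moreover have "4 * a / m * a = 4 * a\<^sup>2 / m" by (simp add: power2_eq_square)
    then have "4 * a / m * a = 8 * ln (real k)" using m by (simp add: a2)
    moreover have "(l s)\<^sup>2 * real M / 8 * real s = 4 * ln (real k)"
    proof -
      have "(l s)\<^sup>2 = (\<sigma> * \<sigma>) * (16 * a\<^sup>2 / m\<^sup>2)"
        by (simp add: l_def a_def m_def power2_eq_square)
      then have "(l s)\<^sup>2 = 16 * a\<^sup>2 / m\<^sup>2" by (simp add: \<sigma>2)
      then have "(l s)\<^sup>2 * m / 8 = 2 * a\<^sup>2 / m" using m by (simp add: power2_eq_square)
      then have "(l s)\<^sup>2 * m / 8 = 4 * ln (real k)" using m by (simp add: a2)
      then show ?thesis by (simp add: m_def mult_ac)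
    qed
    ultimately have "4 * ln (real k) \<le> l s * dev (H u k w) i w - (l s)\<^sup>2 * real M / 8 * real s"
      by (simp add: l_def a_def m_def mult_ac)
    then have "exp (4 * ln (real k)) \<le> expo (l s) i k w" by (simp add: expo_def s_def)
    moreover have "exp (4 * ln (real k)) = real k ^ 4" using k exp_of_nat_mult[of 4 "ln (real k)"] by simp
    ultimately have "E w \<le> expo (l s) i k w / real k ^ 4" using k True by (simp add: E_def)
    also have "\<dots> \<le> (\<Sum>s=1..k. expo (l s) i k w / real k ^ 4)"
      using s by (intro member_le_sum) (auto simp: expo_def)
    finally show ?thesis .
  next
    case False
    then show ?thesis by (auto simp: E_def expo_def intro!: sum_nonneg)
  qed
  then have "expectation E \<le> expectation (\<lambda>w. \<Sum>s=1..k. expo (l s) i k w / real k ^ 4)"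
    using expo_supermartingale[OF i] intE by (intro integral_mono) auto
  also have "\<dots> = (\<Sum>s=1..k. expectation (expo (l s) i k) / real k ^ 4)"
    using expo_supermartingale[OF i] by (subst Bochner_Integration.integral_sum) auto
  also have "\<dots> \<le> (\<Sum>s=1..k. 1 / real k ^ 4)"
    using expo_supermartingale[OF i] by (intro sum_mono divide_right_mono) auto
  also have "\<dots> = 1 / real k ^ 3" using k by (simp add: power_numeral_reduce)
  finally show "expectation E \<le> 1 / real k ^ 3" .
qed

section \<open>Expected counts and rewards of single rounds\<close>

definition otherwise :: "nat \<Rightarrow> 'a \<Rightarrow> bool" where
  "otherwise k w \<longleftrightarrow> next_at u k w \<noteq> None \<and> next_at u k w \<noteq> Some istar"

definition count_bound :: "nat \<Rightarrow> 'a \<Rightarrow> real" where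
  "count_bound i w = cutoff i + 1 +
    (\<Sum>k=N..<horizon. of_bool (overestimated i k w) + of_bool (underestimated istar k w))"

lemma count_bound_expectation:
  assumes i: "i \<in> {1..N}"
  shows "integrable P (count_bound i)" "expectation (count_bound i) \<le> cutoff i + 1 + pi\<^sup>2 / 3"
proof -
  have o: "integrable P (\<lambda>w. of_bool (overestimated i k w) :: real)"
      "expectation (\<lambda>w. of_bool (overestimated i k w)) \<le> 1 / real k ^ 3" if "1 \<le> k" for k
    using deviation_event_prob[OF i that, of 1] by (simp_all add: overestimated_def)
  have un: "integrable P (\<lambda>w. of_bool (underestimated istar k w) :: real)"
      "expectation (\<lambda>w. of_bool (underestimated istar k w)) \<le> 1 / real k ^ 3" if "1 \<le> k" for k
    using deviation_event_prob[OF istar that, of "-1"] by (simp_all add: underestimated_def)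
  have int: "integrable P (\<lambda>w. \<Sum>k=N..<horizon. of_bool (overestimated i k w) + of_bool (underestimated istar k w) :: real)"
    using o(1) un(1) N2 by (intro Bochner_Integration.integrable_sum Bochner_Integration.integrable_add) auto
  show "integrable P (count_bound i)" unfolding count_bound_def[abs_def] using int by simp
  have "expectation (\<lambda>w. \<Sum>k=N..<horizon. of_bool (overestimated i k w) + of_bool (underestimated istar k w) :: real)
    = (\<Sum>k=N..<horizon. expectation (\<lambda>w. of_bool (overestimated i k w)) + expectation (\<lambda>w. of_bool (underestimated istar k w)))"
    using o(1) un(1) N2 by (subst Bochner_Integration.integral_sum) auto
  also have "\<dots> \<le> (\<Sum>k=N..<horizon. 1 / real k ^ 3 + 1 / real k ^ 3)"
    using o(2) un(2) N2 by (intro sum_mono add_mono) auto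
  also have "\<dots> = (\<Sum>k=N..<horizon. 2 / real k ^ 3)" by simp
  also have "\<dots> \<le> pi\<^sup>2 / 3" using N2 by (intro sum_inverse_cubes_le) simp
  finally show "expectation (count_bound i) \<le> cutoff i + 1 + pi\<^sup>2 / 3"
    unfolding count_bound_def[abs_def] using int by (simp add: prob_space)
qed

definition reward :: "nat \<Rightarrow> nat \<Rightarrow> 'a \<Rightarrow> real" where
  "reward i k w = ln (\<Sum>j=1..M. u i j (Suc k) w)"

lemma round_sum_bounds:
  assumes "i \<in> {1..N}" "w \<in> space P"
  shows "real M * umin \<le> (\<Sum>j=1..M. u i j (Suc k) w)" "(\<Sum>j=1..M. u i j (Suc k) w) \<le> real M * umax"
  using sum_bounded_below[of "{1..M}" umin "\<lambda>j. u i j (Suc k) w"]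
    sum_bounded_above[of "{1..M}" "\<lambda>j. u i j (Suc k) w" umax] bounded assms by auto

lemma round_sum_measurable:
  assumes "i \<in> {1..N}"
  shows "(\<lambda>w. \<Sum>j=1..M. u i j (Suc k) w) \<in> borel_measurable P"
  using meas assms by (intro borel_measurable_sum) auto

lemma M_umin_pos: "1 \<le> real M * umin"
  using mult_mono[of 1 "real M" 1 umin] M1 urange by simp

lemma reward_bounds:
  assumes "i \<in> {1..N}" "w \<in> space P"
  shows "ln (real M * umin) \<le> reward i k w" "reward i k w \<le> ln (real M * umax)"
  using round_sum_bounds[OF assms, of k] M_umin_pos by (auto simp: reward_def)

lemma log_lower_nonneg: "0 \<le> ln (real M * umin)"
  using M_umin_pos by simp

lemma reward_measurable: "i \<in> {1..N} \<Longrightarrow> reward i k \<in> borel_measurable P"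
  unfolding reward_def[abs_def] using round_sum_measurable by (intro borel_measurable_ln)

lemma reward_integrable:
  assumes i: "i \<in> {1..N}"
  shows "integrable P (reward i k)"
proof (rule integrable_const_bound[where B = "ln (real M * umax)"])
  have "\<bar>reward i k w\<bar> \<le> ln (real M * umax)" if "w \<in> space P" for w
    using reward_bounds[OF i that, of k] log_lower_nonneg by linarith
  then show "AE w in P. norm (reward i k w) \<le> ln (real M * umax)" by (intro AE_I2) simp
qed (rule reward_measurable[OF i])

text \<open>Jensen's inequality for the logarithm, proved with the tangent line at the mean
  \<open>m\<close>.\<close>

lemma reward_expectation_le:
  assumes i: "i \<in> {1..N}"
  shows "expectation (reward i k) \<le> ln (real M * U i)"
proof -
  define m where "m = real M * U i"
  have m: "m > 0" using U_bounds[OF i] urange Mpos by (simp add: m_def)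
  have int: "integrable P (u i j (Suc k))" if "j \<in> {1..M}" for j
  proof (rule integrable_const_bound[where B = umax])
    have "\<bar>u i j (Suc k) w\<bar> \<le> umax" if w: "w \<in> space P" for w
    proof -
      have "umin \<le> u i j (Suc k) w" "u i j (Suc k) w \<le> umax" using bounded w i \<open>j \<in> {1..M}\<close> by auto
      then show ?thesis using urange by linarith
    qed
    then show "AE w in P. norm (u i j (Suc k) w) \<le> umax" by (intro AE_I2) simp
  qed (use meas i that in auto)
  have ints: "integrable P (\<lambda>w. \<Sum>j=1..M. u i j (Suc k) w)"
    using int by (intro Bochner_Integration.integrable_sum)
  have "expectation (\<lambda>w. \<Sum>j=1..M. u i j (Suc k) w) = (\<Sum>j=1..M. expectation (u i j (Suc k)))"
    using int by (intro Bochner_Integration.integral_sum)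
  also have "\<dots> = m" using mean i by (simp add: m_def)
  finally have E: "expectation (\<lambda>w. \<Sum>j=1..M. u i j (Suc k) w) = m" .
  have "expectation (reward i k) \<le> expectation (\<lambda>w. ln m + (\<Sum>j=1..M. u i j (Suc k) w) / m - 1)"
  proof (rule integral_mono)
    fix w assume w: "w \<in> space P"
    let ?s = "\<Sum>j=1..M. u i j (Suc k) w"
    have s: "?s > 0" using round_sum_bounds[OF i w, of k] M_umin_pos by linarith
    have "ln (?s / m) \<le> ?s / m - 1" using s m by (intro ln_le_minus_one) simp
    then show "reward i k w \<le> ln m + ?s / m - 1" using s m by (simp add: reward_def ln_div)
  qed (use ints reward_integrable[OF i] in auto)
  also have "\<dots> = ln m" using ints E m by (simp add: prob_space)
  finally show ?thesis by (simp add: m_def)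
qed

lemma indicator_integrable:
  fixes A :: "nat option set"
  shows "integrable P (\<lambda>w. of_bool (next_at u k w \<in> A) :: real)"
proof (rule integrable_const_bound[where B = 1])
  show "(\<lambda>w. of_bool (next_at u k w \<in> A) :: real) \<in> borel_measurable P"
    using measurable_past[of "\<lambda>hs a d. of_bool (a \<in> A)" istar k] istar by simp
qed auto

text \<open>The decision to play \<open>istar\<close> precedes the observations of that round and is
  independent of them. Hence optimal rounds of the algorithm and of the benchmark cancel in
  expectation.\<close>

lemma optimal_reward_split:
  defines "E \<equiv> \<lambda>k w. of_bool (next_at u k w = Some istar) :: real"
  shows "integrable P (\<lambda>w. E k w * reward istar k w)"
    "expectation (\<lambda>w. E k w * reward istar k w) = expectation (E k) * expectation (reward istar k)"
proof -
  have ind: "indep_var borel (E k) borel (reward istar k)"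
    unfolding E_def reward_def[abs_def]
    using indep_past_next_round[of "\<lambda>hs a d. of_bool (a = Some istar)" istar ln k] istar by simp
  have iE: "integrable P (E k)" using indicator_integrable[of k "{Some istar}"] by (simp add: E_def)
  show "integrable P (\<lambda>w. E k w * reward istar k w)"
    by (rule indep_var_integrable[OF ind iE reward_integrable[OF istar]])
  show "expectation (\<lambda>w. E k w * reward istar k w) = expectation (E k) * expectation (reward istar k)"
    by (rule indep_var_lebesgue_integral[OF ind iE reward_integrable[OF istar]])
qed

section \<open>Reduction of the regret to missing rounds and suboptimal selections\<close>

definition rounds :: nat where "rounds = nat \<lfloor>B / (real M * c istar)\<rfloor> + 1"

lemma rounds_le: "rounds \<le> Suc horizon"
proof -
  have "B / (real M * c istar) \<le> B / (real M * cmin N c)"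
    using cmin_le[OF istar] cmin_pos Mpos B_nonneg by (intro divide_left_mono) auto
  then show ?thesis unfolding rounds_def horizon_def by (simp add: floor_mono nat_mono)
qed

text \<open>The random arm index is removed by summing indicators over all arms, which leaves
  finitely many terms dominated by integrable rewards.\<close>

lemma alg_reward_integrable: "integrable P (alg_reward N M c B pick u)"
proof -
  define R where "R = (\<lambda>w. \<Sum>k<horizon. \<Sum>a=1..N. of_bool (next_at u k w = Some a) * reward a k w)"
  have R: "alg_reward N M c B pick u w = R w" for w
  proof -
    have "(if next_at u k w = None then 0 else ln (\<Sum>j=1..M. u (choice u k w) j (Suc k) w)) =
      (\<Sum>a=1..N. of_bool (next_at u k w = Some a) * reward a k w)" for k
    proof (cases "next_at u k w")
      case (Some b)
      have "(\<Sum>a=1..N. of_bool (next_at u k w = Some a) * reward a k w) =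
        (\<Sum>a=1..N. if a = b then reward a k w else 0)"
        using Some by (intro sum.cong) auto
      also have "\<dots> = reward b k w" using next_at_range[OF Some] by simp
      finally show ?thesis using Some by (simp add: reward_def)
    qed simp
    then show ?thesis using alg_reward_eq[OF stop_le_horizon[of u w]] by (simp add: R_def)
  qed
  have "integrable P (\<lambda>w. of_bool (next_at u k w = Some a) * reward a k w)" if a: "a \<in> {1..N}" for a k
  proof (rule Bochner_Integration.integrable_bound[OF reward_integrable[OF a]])
    show "(\<lambda>w. of_bool (next_at u k w = Some a) * reward a k w) \<in> borel_measurable P"
      using indicator_integrable[of k "{Some a}"] reward_measurable[OF a, of k]
      by (intro borel_measurable_times) (auto dest: borel_measurable_integrable)
  qed (auto intro!: AE_I2)
  then have "integrable P R" unfolding R_def by (intro Bochner_Integration.integrable_sum) auto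
  then show ?thesis by (simp add: R[abs_def])
qed

abbreviation "L \<equiv> ln (real M * U istar)"
abbreviation "ell \<equiv> ln (U istar / umin)"

text \<open>A suboptimal selection is credited only with the guaranteed reward
  \<open>ln (real M * umin)\<close>, so \<open>ell\<close> is its loss relative to
  \<open>L\<close>.\<close>

lemma L_split: "L - ell = ln (real M * umin)" "0 \<le> ell" "ell \<le> L"
proof -
  have U: "umin \<le> U istar" using U_bounds[OF istar] by simp
  then show *: "L - ell = ln (real M * umin)" using urange Mpos by (simp add: ln_mult ln_div)
  show "0 \<le> ell" using U urange by simp
  show "ell \<le> L" using * log_lower_nonneg by linarith
qed

text \<open>Each benchmark round is compared with the same round of the run, which is optimal
  (\<open>p\<close>), suboptimal (\<open>q\<close>) or already stopped (\<open>e\<close>). Algorithm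
  rewards after the benchmark's last round are dropped, being nonnegative.\<close>

lemma regret_le_loss:
  "exp_regret P N M c B pick istar u \<le>
    expectation (\<lambda>w. \<Sum>k<rounds. L * of_bool (next_at u k w = None) + ell * of_bool (otherwise k w))"
proof -
  define p where "p = (\<lambda>k w. of_bool (next_at u k w = Some istar) :: real)"
  define q where "q = (\<lambda>k w. of_bool (otherwise k w) :: real)"
  define e where "e = (\<lambda>k w. of_bool (next_at u k w = None) :: real)"
  define m where "m = ln (real M * umin)"
  have ip: "integrable P (p k)" for k
    using indicator_integrable[of k "{Some istar}"] by (simp add: p_def)
  have ie: "integrable P (e k)" for k
    using indicator_integrable[of k "{None}"] by (simp add: e_def)
  have iq: "integrable P (q k)" for k
    using indicator_integrable[of k "- {None, Some istar}"] by (simp add: q_def otherwise_def)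
  have ix: "integrable P (\<lambda>w. p k w * reward istar k w)"
    and ex: "expectation (\<lambda>w. p k w * reward istar k w) = expectation (p k) * expectation (reward istar k)" for k
    using optimal_reward_split by (auto simp: p_def)
  have total: "expectation (p k) + expectation (q k) + expectation (e k) = 1" for k
  proof -
    have "p k w + q k w + e k w = 1" for w by (auto simp: p_def q_def e_def otherwise_def)
    then have "expectation (\<lambda>w. p k w + q k w + e k w) = 1" by (simp add: prob_space)
    then show ?thesis using ip iq ie by simp
  qed
  have nonneg: "expectation (q k) \<ge> 0" "expectation (e k) \<ge> 0" for k
    by (auto simp: q_def e_def intro!: Bochner_Integration.integral_nonneg)
  have bench: "expectation (bench_reward M c B istar u) = (\<Sum>k<rounds. expectation (reward istar k))"
  proof -
    have "bench_reward M c B istar u w = (\<Sum>k<rounds. reward istar k w)" for w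
      unfolding bench_reward_def rounds_def reward_def by (simp add: sum.atLeast1_atMost_eq)
    then have "bench_reward M c B istar u = (\<lambda>w. \<Sum>k<rounds. reward istar k w)" by (rule ext)
    then show ?thesis using reward_integrable[OF istar] by simp
  qed
  have "(\<Sum>k<rounds. p k w * reward istar k w + q k w * m) \<le> alg_reward N M c B pick u w"
    if w: "w \<in> space P" for w
  proof -
    let ?R = "\<lambda>k. if next_at u k w = None then 0 else ln (\<Sum>j=1..M. u (choice u k w) j (Suc k) w)"
    have R: "p k w * reward istar k w + q k w * m \<le> ?R k \<and> 0 \<le> ?R k" for k
    proof (cases "next_at u k w")
      case (Some a)
      have "m \<le> reward a k w" using reward_bounds(1)[OF next_at_range[OF Some] w] by (simp add: m_def)
      then show ?thesis using Some log_lower_nonneg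
        by (cases "a = istar") (auto simp: p_def q_def otherwise_def reward_def m_def)
    qed (simp add: p_def q_def otherwise_def)
    have "(\<Sum>k<rounds. p k w * reward istar k w + q k w * m) \<le> (\<Sum>k<rounds. ?R k)"
      using R by (intro sum_mono) blast
    \<comment> \<open>The benchmark can exceed the horizon by its additional round, hence
      \<open>Suc\<close>; the run contributes 0 there.\<close>
    also have "\<dots> \<le> (\<Sum>k<Suc horizon. ?R k)"
      using R rounds_le by (intro sum_mono2) auto
    also have "\<dots> = alg_reward N M c B pick u w"
      using alg_reward_eq[of u w "Suc horizon"] stop_le_horizon[of u w] by simp
    finally show ?thesis .
  qed
  then have "expectation (\<lambda>w. \<Sum>k<rounds. p k w * reward istar k w + q k w * m) \<le> expectation (alg_reward N M c B pick u)"
    using alg_reward_integrable ix iq by (intro integral_mono) auto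
  moreover have "expectation (\<lambda>w. \<Sum>k<rounds. p k w * reward istar k w + q k w * m) =
    (\<Sum>k<rounds. expectation (p k) * expectation (reward istar k) + expectation (q k) * m)"
    using ix iq by (simp add: ex)
  ultimately have "exp_regret P N M c B pick istar u \<le> (\<Sum>k<rounds. expectation (reward istar k) -
      (expectation (p k) * expectation (reward istar k) + expectation (q k) * m))"
    unfolding exp_regret_def bench by (simp add: sum_subtractf)
  also have "\<dots> \<le> (\<Sum>k<rounds. L * expectation (e k) + ell * expectation (q k))"
  proof (rule sum_mono)
    fix k
    \<comment> \<open>As the three probabilities add up to 1, what remains of the benchmark reward
      is weighted by \<open>q\<close> and \<open>e\<close>, and \<open>L\<close> bounds it by
      Jensen.\<close>
    have "expectation (reward istar k) * (expectation (q k) + expectation (e k))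
        \<le> L * (expectation (q k) + expectation (e k))"
      using nonneg[of k] by (intro mult_right_mono reward_expectation_le istar) auto
    moreover have p: "expectation (p k) = 1 - expectation (q k) - expectation (e k)" using total[of k] by simp
    have m: "m = L - ell" using L_split by (simp add: m_def)
    have "expectation (reward istar k) - (expectation (p k) * expectation (reward istar k) + expectation (q k) * m)
      = expectation (reward istar k) * (expectation (q k) + expectation (e k)) - (L - ell) * expectation (q k)"
      unfolding p m by (simp only: ring_distribs) simp
    moreover have "L * (expectation (q k) + expectation (e k)) - (L - ell) * expectation (q k)
      = L * expectation (e k) + ell * expectation (q k)"
      by (simp only: ring_distribs)
    ultimately show "expectation (reward istar k) -
      (expectation (p k) * expectation (reward istar k) + expectation (q k) * m) \<le> L * expectation (e k) + ell * expectation (q k)"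
      by linarith
  qed
  also have "\<dots> = expectation (\<lambda>w. \<Sum>k<rounds. L * e k w + ell * q k w)"
    using ie iq by simp
  finally show ?thesis by (simp add: e_def q_def)
qed

section \<open>Assembling the bound\<close>

abbreviation "dearer \<equiv> {i\<in>{1..N}. c i - c istar > 0}"

lemma loss_le_counts:
  assumes w: "w \<in> space P"
  shows "(\<Sum>k<rounds. L * of_bool (next_at u k w = None) + ell * of_bool (otherwise k w)) \<le>
    L * (1 + cmin N c / c istar + (\<Sum>i\<in>dearer. (c i - c istar) / c istar * count_bound i w))
    + ell * (1 + (\<Sum>i\<in>{1..N} - {istar}. count_bound i w))"
proof -
  define \<tau> where "\<tau> = stop u w"
  define x where "x = (\<lambda>k. c (choice u k w))"
  define Z where "Z = (\<lambda>i. {k. k < horizon \<and> next_at u k w = Some i \<and> regular k w})"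
  have act: "k < \<tau> \<longleftrightarrow> next_at u k w \<noteq> None" for k
    using active_iff[of u k w] by (simp add: \<tau>_def)
  have inact: "next_at u k w = None \<longleftrightarrow> \<tau> \<le> k" for k
    using act[of k] by (auto simp: not_less)
  have nxt: "next_at u k w = Some (choice u k w)" if "k < \<tau>" for k
    using next_at_eq_choice that by (simp add: \<tau>_def)
  have rng: "choice u k w \<in> {1..N}" if "k < \<tau>" for k
    using next_at_range[OF nxt[OF that]] .
  have cs: "c istar > 0" using cpos istar by blast
  have \<tau>_hor: "\<tau> \<le> horizon" using stop_le_horizon[of u w] by (simp add: \<tau>_def)
  have left_x: "left (H u k w) = B - real M * (\<Sum>j<k. x j)" if "k \<le> \<tau>" for k
    using left_hist[of k u w] that by (simp add: \<tau>_def x_def)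
  have left_div: "left (H u k w) / real M = B / real M - (\<Sum>j<k. x j)" if "k \<le> \<tau>" for k
    using left_x[OF that] Mpos by (simp add: field_simps)
  have Zcard: "real (card (Z i)) \<le> count_bound i w" if "i \<in> {1..N}" "i \<noteq> istar" for i
    using regular_pulls_bound[OF w that] by (simp add: Z_def count_bound_def)
  have finZ: "finite (Z i)" for i by (simp add: Z_def)
  have "(\<Sum>k<rounds. L * of_bool (next_at u k w = None) + ell * of_bool (otherwise k w)) =
    L * real (rounds - \<tau>) + ell * real (card {k. k < rounds \<and> k < \<tau> \<and> otherwise k w})"
  proof -
    have "{..<rounds} \<inter> {k. next_at u k w = None} = {\<tau>..<rounds}" by (auto simp: inact)
    moreover have "{..<rounds} \<inter> {k. otherwise k w} = {k. k < rounds \<and> k < \<tau> \<and> otherwise k w}"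
      using act by (auto simp: otherwise_def)
    ultimately show ?thesis
      by (simp only: sum.distrib sum_distrib_left[symmetric] sum_of_bool_eq finite_lessThan card_atLeastLessThan)
  qed
  also have "\<dots> \<le> L * (1 + cmin N c / c istar + (\<Sum>k | k < \<tau> \<and> regular k w. max 0 (x k - c istar) / c istar))
    + ell * (1 + real (card {k. k < \<tau> \<and> regular k w \<and> otherwise k w}))"
  \<comment> \<open>A selection costs \<open>M\<close> times the unit cost, so path costs are unit
    costs and the budget is \<open>B / real M\<close>.\<close>
  proof (rule path_loss_bound[where b = "B / real M"])
    show "0 < x k" if "k < \<tau>" for k using rng[OF that] cpos by (simp add: x_def)
    show "(\<Sum>k<\<tau>. x k) \<le> B / real M"
      using left_div[of \<tau>] left_nonneg[of u \<tau> w] Mpos by (simp add: field_simps)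
    show "B / real M - (\<Sum>k<\<tau>. x k) < cmin N c"
      using left_div[of \<tau>] left_after_stop[of u w] Mpos by (simp add: \<tau>_def field_simps)
    show "B / real M - (\<Sum>j<k. x j) < c istar" if "k < \<tau>" "\<not> regular k w" for k
      using left_div[of k] that Mpos by (simp add: regular_def field_simps)
    have "real (nat \<lfloor>B / (real M * c istar)\<rfloor>) \<le> B / (real M * c istar)"
      using B_nonneg cs by (intro of_nat_floor) auto
    then show "real rounds \<le> B / real M / c istar + 1" by (simp add: rounds_def)
  qed (use L_split cs cmin_pos in auto)
  also have "(\<Sum>k | k < \<tau> \<and> regular k w. max 0 (x k - c istar) / c istar)
      \<le> (\<Sum>i\<in>dearer. (c i - c istar) / c istar * count_bound i w)"
  proof -
    have "(\<Sum>k | k < \<tau> \<and> regular k w. max 0 (x k - c istar) / c istar) =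
      (\<Sum>k\<in>(\<Union>i\<in>dearer. Z i). max 0 (x k - c istar) / c istar)"
    proof (rule sum.mono_neutral_right)
      show "(\<Union>i\<in>dearer. Z i) \<subseteq> {k. k < \<tau> \<and> regular k w}" using act by (auto simp: Z_def)
      \<comment> \<open>Regular rounds outside the union play an arm no dearer than
        \<open>istar\<close>, for which the positive part of the excess cost vanishes.\<close>
      show "\<forall>k\<in>{k. k < \<tau> \<and> regular k w} - (\<Union>i\<in>dearer. Z i). max 0 (x k - c istar) / c istar = 0"
      proof
        fix k assume k: "k \<in> {k. k < \<tau> \<and> regular k w} - (\<Union>i\<in>dearer. Z i)"
        then have "choice u k w \<notin> dearer" using nxt[of k] \<tau>_hor by (auto simp: Z_def)
        then show "max 0 (x k - c istar) / c istar = 0" using rng[of k] k by (auto simp: x_def)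
      qed
    qed auto
    also have "\<dots> = (\<Sum>i\<in>dearer. \<Sum>k\<in>Z i. max 0 (x k - c istar) / c istar)"
      using finZ by (intro sum.UNION_disjoint) (auto simp: Z_def)
    also have "\<dots> = (\<Sum>i\<in>dearer. (c i - c istar) / c istar * real (card (Z i)))"
    proof (intro sum.cong refl)
      fix i assume "i \<in> dearer"
      then have "(\<Sum>k\<in>Z i. max 0 (x k - c istar) / c istar) = (\<Sum>k\<in>Z i. (c i - c istar) / c istar)"
        by (intro sum.cong) (auto simp: Z_def x_def)
      then show "(\<Sum>k\<in>Z i. max 0 (x k - c istar) / c istar) = (c i - c istar) / c istar * real (card (Z i))"
        by simp
    qed
    also have "\<dots> \<le> (\<Sum>i\<in>dearer. (c i - c istar) / c istar * count_bound i w)"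
      using cs by (intro sum_mono mult_left_mono Zcard) auto
    finally show ?thesis .
  qed
  also have "real (card {k. k < \<tau> \<and> regular k w \<and> otherwise k w}) \<le> (\<Sum>i\<in>{1..N} - {istar}. count_bound i w)"
  proof -
    have "{k. k < \<tau> \<and> regular k w \<and> otherwise k w} \<subseteq> (\<Union>i\<in>{1..N} - {istar}. Z i)"
    proof
      fix k assume k: "k \<in> {k. k < \<tau> \<and> regular k w \<and> otherwise k w}"
      then have "k \<in> Z (choice u k w)" using nxt[of k] \<tau>_hor by (simp add: Z_def)
      moreover have "choice u k w \<in> {1..N} - {istar}" using k rng[of k] nxt[of k] by (auto simp: otherwise_def)
      ultimately show "k \<in> (\<Union>i\<in>{1..N} - {istar}. Z i)" by blast
    qed
    then have "card {k. k < \<tau> \<and> regular k w \<and> otherwise k w} \<le> card (\<Union>i\<in>{1..N} - {istar}. Z i)"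
      using finZ by (intro card_mono) auto
    also have "\<dots> \<le> (\<Sum>i\<in>{1..N} - {istar}. card (Z i))" by (intro card_UN_le) auto
    finally have "real (card {k. k < \<tau> \<and> regular k w \<and> otherwise k w}) \<le> (\<Sum>i\<in>{1..N} - {istar}. real (card (Z i)))"
      by (simp flip: of_nat_sum)
    also have "\<dots> \<le> (\<Sum>i\<in>{1..N} - {istar}. count_bound i w)" using Zcard by (intro sum_mono) auto
    finally show ?thesis .
  qed
  finally show ?thesis using L_split by (simp add: mult_left_mono)
qed

lemma regret_bound:
  "exp_regret P N M c B pick istar u \<le>
    L * (1 + cmin N c / c istar + (\<Sum>i\<in>dearer. (c i - c istar) / c istar * (cutoff i + 1 + pi\<^sup>2 / 3)))
    + ell * real N * Max ((\<lambda>i. cutoff i + 1 + pi\<^sup>2 / 3) ` ({1..N} - {istar}))"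
proof -
  define D where "D = (\<lambda>i. cutoff i + 1 + pi\<^sup>2 / 3)"
  define Q where "Q = (\<lambda>w. L * (1 + cmin N c / c istar + (\<Sum>i\<in>dearer. (c i - c istar) / c istar * count_bound i w))
    + ell * (1 + (\<Sum>i\<in>{1..N} - {istar}. count_bound i w)))"
  have cs: "c istar > 0" using cpos istar by blast
  have cb: "integrable P (count_bound i)" "expectation (count_bound i) \<le> D i" if "i \<in> {1..N}" for i
    using count_bound_expectation[OF that] by (auto simp: D_def)
  have iQ1: "integrable P (\<lambda>w. \<Sum>i\<in>dearer. (c i - c istar) / c istar * count_bound i w)"
    using cb by (intro Bochner_Integration.integrable_sum integrable_mult_right) auto
  have iQ2: "integrable P (\<lambda>w. \<Sum>i\<in>{1..N} - {istar}. count_bound i w)"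
    using cb by (intro Bochner_Integration.integrable_sum) auto
  have iQ: "integrable P Q" unfolding Q_def using iQ1 iQ2
    by (intro Bochner_Integration.integrable_add integrable_mult_right) auto
  have "exp_regret P N M c B pick istar u \<le>
    expectation (\<lambda>w. \<Sum>k<rounds. L * of_bool (next_at u k w = None) + ell * of_bool (otherwise k w))"
    by (rule regret_le_loss)
  also have "\<dots> \<le> expectation Q"
  proof (rule integral_mono)
    show "integrable P (\<lambda>w. \<Sum>k<rounds. L * of_bool (next_at u k w = None) + ell * of_bool (otherwise k w))"
      using indicator_integrable[of _ "{None}"] indicator_integrable[of _ "- {None, Some istar}"]
      by (intro Bochner_Integration.integrable_sum Bochner_Integration.integrable_add integrable_mult_right)
        (simp_all add: otherwise_def)
  qed (use iQ loss_le_counts in \<open>auto simp: Q_def\<close>)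
  also have "expectation Q = L * (1 + cmin N c / c istar + (\<Sum>i\<in>dearer. (c i - c istar) / c istar * expectation (count_bound i)))
    + ell * (1 + (\<Sum>i\<in>{1..N} - {istar}. expectation (count_bound i)))"
  proof -
    have "expectation (\<lambda>w. \<Sum>i\<in>dearer. (c i - c istar) / c istar * count_bound i w) =
        (\<Sum>i\<in>dearer. (c i - c istar) / c istar * expectation (count_bound i))"
      using cb by (subst Bochner_Integration.integral_sum) auto
    moreover have "expectation (\<lambda>w. \<Sum>i\<in>{1..N} - {istar}. count_bound i w) =
        (\<Sum>i\<in>{1..N} - {istar}. expectation (count_bound i))"
      using cb by (subst Bochner_Integration.integral_sum) auto
    ultimately show ?thesis unfolding Q_def using iQ1 iQ2 by (simp add: prob_space)
  qed
  also have "\<dots> \<le> L * (1 + cmin N c / c istar + (\<Sum>i\<in>dearer. (c i - c istar) / c istar * D i))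
    + ell * (real N * Max (D ` ({1..N} - {istar})))"
  proof (intro add_mono mult_left_mono sum_mono)
    let ?m = "Max (D ` ({1..N} - {istar}))"
    have le: "D i \<le> ?m" if "i \<in> {1..N} - {istar}" for i using that by (intro Max_ge) auto
    \<comment> \<open>Since \<open>N\<close> is at least 2, arm 1 or arm 2 is suboptimal, so the
      maximum is at least 1. The additional 1 from the final phase then fits beside the
      \<open>N - 1\<close> suboptimal arms into \<open>N\<close> copies of the maximum.\<close>
    have ne: "(if istar = 1 then 2 else 1) \<in> {1..N} - {istar}" using N2 by auto
    have "1 \<le> ?m" using le[OF ne] cutoff_nonneg[of "if istar = 1 then 2 else 1"]
      by (simp only: D_def) (smt (verit) zero_le_power2 divide_nonneg_pos)
    moreover have "(\<Sum>i\<in>{1..N} - {istar}. expectation (count_bound i)) \<le> (\<Sum>i\<in>{1..N} - {istar}. ?m)"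
      using le cb(2) by (intro sum_mono) (meson Diff_iff order_trans)
    moreover have "real (card ({1..N} - {istar})) = real N - 1" using istar by (simp add: of_nat_diff)
    moreover have "(real N - 1) * ?m = real N * ?m - ?m" by (simp add: left_diff_distrib)
    ultimately show "1 + (\<Sum>i\<in>{1..N} - {istar}. expectation (count_bound i)) \<le> real N * ?m"
      by (simp only: sum_constant)
    show "expectation (count_bound i) \<le> D i" if "i \<in> dearer" for i using cb(2) that by simp
  qed (use L_split cs in auto)
  finally show ?thesis by (simp add: D_def mult.assoc)
qed

end

theorem theorem3:
  fixes P :: "'a measure" and N M :: nat and c U :: "nat \<Rightarrow> real"
    and B umin umax :: real and istar :: nat
    and u :: "nat \<Rightarrow> nat \<Rightarrow> nat \<Rightarrow> 'a \<Rightarrow> real"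
    and pick :: "nat set \<Rightarrow> nat"
  assumes prob: "prob_space P"
    and N2: "N \<ge> 2" and M1: "M \<ge> 1"
    and cpos: "\<forall>i\<in>{1..N}. c i > 0"
    and Bpos: "B > 0"
    and Blarge: "B \<ge> real M * (\<Sum>i=1..N. c i)"
    and urange: "1 \<le> umin" "umin \<le> umax" "umax \<le> 2"
    and meas: "\<forall>i\<in>{1..N}. \<forall>j\<in>{1..M}. \<forall>t\<ge>1. u i j t \<in> borel_measurable P"
    and indep: "prob_space.indep_vars P (\<lambda>_. borel) (\<lambda>(i, j, t). u i j t)
                  ({1..N} \<times> {1..M} \<times> {1..})"
    and bounded: "\<forall>i\<in>{1..N}. \<forall>j\<in>{1..M}. \<forall>t\<ge>1. \<forall>w\<in>space P.
                    umin \<le> u i j t w \<and> u i j t w \<le> umax"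
    and mean: "\<forall>i\<in>{1..N}. \<forall>j\<in>{1..M}. \<forall>t\<ge>1. (\<integral>w. u i j t w \<partial>P) = U i"
    and istar: "istar \<in> {1..N}"
    and istar_opt: "\<forall>i\<in>{1..N}. i \<noteq> istar \<longrightarrow> ln (U i) / c i < ln (U istar) / c istar"
    and pick: "\<forall>S. finite S \<and> S \<noteq> {} \<longrightarrow> pick S \<in> S"
  shows "exp_regret P N M c B pick istar u \<le>
     ln (real M * U istar) *
       (1 + cmin N c / c istar
          + (\<Sum>i\<in>{i\<in>{1..N}. c i - c istar > 0}.
               (c i - c istar) / c istar *
               (8 * ln (B / (real M * cmin N c))
                  / (real M * (c i)\<^sup>2 * (ln (U istar) / c istar - ln (U i) / c i)\<^sup>2)
                + 1 + pi\<^sup>2 / 3)))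
     + ln (U istar / umin) * real N *
       Max ((\<lambda>i. 8 * ln (B / (real M * cmin N c))
                  / (real M * (c i)\<^sup>2 * (ln (U istar) / c istar - ln (U i) / c i)\<^sup>2)
                + 1 + pi\<^sup>2 / 3) ` ({1..N} - {istar}))"
proof -
  interpret prob_space P by (rule prob)
  interpret bandit N M c B pick P U umin umax istar u
    by unfold_locales (fact N2 M1 cpos Blarge pick urange meas indep bounded mean istar istar_opt)+
  show ?thesis using regret_bound by (simp add: cutoff_def gap_def)
qed

end
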